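(* Let $q$ be an odd prime power. Then: (1) if $q^2-q+1$ is prime, then $PSU_3(q)$ has a minimal logarithmic signature; (2) if $q > 5$ and $q+1 = 2p$ for some prime $p$, then $PSU_3(q)$ has a minimal logarithmic signature.
   Context: All groups are finite. For a finite group $G$, a logarithmic signature of $G$ is an ordered tuple $[A_1,\ldots,A_s]$ of subsets $A_i \subseteq G$ such that every element $g \in G$ can be written uniquely as a product $g = a_1a_2\cdots a_s$ with $a_i \in A_i$ for each $i$. Its length is $\sum_{i=1}^s |A_i|$. If $|G| = p_1^{\beta_1}\cdots p_k^{\beta_k}$ with $p_1,\ldots,p_k$ distinct primes and $\beta_j \ge 1$, every logarithmic signature has length at least $\sum_{j=1}^k \beta_j p_j$, and a logarithmic signature is called minimal (an MLS) if its length equals $\sum_{j=1}^k \beta_j p_j$. $PSU_3(q)$ is the projective special unitary group $SU_3(q)/Z(SU_3(q))$, where $SU_3(q)$ is the special unitary group of dimension $3$ over $GF(q^2)$. *)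

theory Defs
  imports "HOL-Analysis.Analysis" "HOL-Algebra.Coset" "HOL-Computational_Algebra.Primes"
begin

section \<open>Logarithmic signatures\<close>

text \<open>A logarithmic signature of a (finite) group G is a list [A_1,...,A_s] of subsets
  of the carrier such that every element g has exactly one factorisation
  g = a_1 ... a_s with a_i in A_i.\<close>

definition log_signature :: "('g, 'b) monoid_scheme \<Rightarrow> 'g set list \<Rightarrow> bool" where
  "log_signature G As \<longleftrightarrow>
     (\<forall>A\<in>set As. A \<subseteq> carrier G) \<and>
     (\<forall>g\<in>carrier G. \<exists>!xs. length xs = length As \<and> (\<forall>i<length As. xs ! i \<in> As ! i) \<and>
                          foldr (\<lambda>x y. x \<otimes>\<^bsub>G\<^esub> y) xs \<one>\<^bsub>G\<^esub> = g)"

definition ls_length :: "'g set list \<Rightarrow> nat" where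
  "ls_length As = sum_list (map card As)"

text \<open>Lower bound sum_j beta_j p_j where |G| = prod_j p_j^beta_j.\<close>
definition mls_bound :: "nat \<Rightarrow> nat" where
  "mls_bound n = (\<Sum>p\<in>prime_factors n. multiplicity p n * p)"

definition has_MLS :: "('g, 'b) monoid_scheme \<Rightarrow> bool" where
  "has_MLS G \<longleftrightarrow> (\<exists>As. log_signature G As \<and> ls_length As = mls_bound (order G))"

section \<open>The groups SU_3(q) and PSU_3(q)\<close>

text \<open>The field GF(q^2) is given as a finite field type 'a with CARD('a) = q^2;
  the field involution is x \<mapsto> x^q.\<close>

definition conjT :: "nat \<Rightarrow> 'a::field ^3^3 \<Rightarrow> 'a ^3^3" where
  "conjT q A = (\<chi> i j. (A $ j $ i) ^ q)"

definition SU3_set :: "nat \<Rightarrow> ('a::field ^3^3) set" where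
  "SU3_set q = {A. A ** conjT q A = mat 1 \<and> det A = 1}"

definition SU3 :: "nat \<Rightarrow> ('a::field ^3^3) monoid" where
  "SU3 q = \<lparr>carrier = SU3_set q, mult = (**), one = mat 1\<rparr>"

definition group_center :: "('g, 'b) monoid_scheme \<Rightarrow> 'g set" where
  "group_center G = {z \<in> carrier G. \<forall>g\<in>carrier G. z \<otimes>\<^bsub>G\<^esub> g = g \<otimes>\<^bsub>G\<^esub> z}"

definition PSU3 :: "nat \<Rightarrow> ('a::field ^3^3) set monoid" where
  "PSU3 q = SU3 q Mod group_center (SU3 q)"

end

theory Submission
  imports Defs "HOL-Algebra.Algebraic_Closure_Type" "HOL-Algebra.Elementary_Groups"
    "HOL-Algebra.Group_Action" "HOL-Algebra.Solvable_Groups" "HOL-Number_Theory.Residues"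
begin

text \<open>
  Either hypothesis forces \<open>3\<close> not to divide \<open>q + 1\<close>, so \<open>PSU\<^sub>3(q) \<cong> SU\<^sub>3(q)\<close>. Finite solvable groups factor minimally,
  by induction along a series with abelian quotients. To factor a group \<open>G\<close> acting on a set with \<open>\<Omega>\<close> an orbit and
  \<open>x \<in> \<Omega>\<close>, it suffices to factor the stabiliser of \<open>x\<close> and to find sets \<open>{x} = P\<^sub>0, \<dots>, P\<^sub>n = \<Omega>\<close> such that each
  \<open>P\<^sub>i\<^sub>+\<^sub>1\<close> is the disjoint union of the translates \<open>a P\<^sub>i\<close> with \<open>a\<close> in a minimally factorisable set. If \<open>P\<^sub>1\<close> has prime
  size, the first of these conditions holds automatically. Put \<open>r = q\<^sup>2 - q + 1\<close>.

  If \<open>r\<close> is prime, take a set \<open>U\<close> of \<open>q\<^sup>2\<close> coset representatives of the centre of a Sylow subgroup for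
  the defining prime. Its translates of a set of \<open>r\<close> points tile the \<open>q\<^sup>2 r\<close> non-isotropic points. The stabiliser of
  a non-isotropic point contains a cyclic group that is regular on the \<open>q + 1\<close> isotropic points orthogonal to it,
  with solvable stabilisers.

  If \<open>q + 1 = 2 p\<close>, a cyclic subgroup \<open>C\<close> of order \<open>r\<close> has \<open>2 p\<close> regular orbits on the \<open>q\<^sup>3 + 1\<close> isotropic
  points. Pair these orbits arbitrarily. Since \<open>G\<close> is two-transitive, a second moment estimate shows that a
  random element maps no point of the first orbit of a given pair into the second with probability at most
  \<open>1 / q\<close>, so some \<open>a\<close> connects all \<open>p\<close> pairs. This gives \<open>G = C {1, a} X B\<close> with \<open>|X| = p\<close> and \<open>B\<close> the
  stabiliser of an isotropic point, which is solvable.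
\<close>

hide_const (open) Divisibility.prime up_ring.coeff up_ring.monom Polynomials.degree
no_notation fps_nth (infixl "$" 75)

section \<open>Minimal factorisations of subsets\<close>

definition group_prod :: "('g, 'b) monoid_scheme \<Rightarrow> 'g list \<Rightarrow> 'g" where
  "group_prod G xs = foldr (\<lambda>x y. x \<otimes>\<^bsub>G\<^esub> y) xs \<one>\<^bsub>G\<^esub>"

definition min_factorisable :: "('g, 'b) monoid_scheme \<Rightarrow> 'g set \<Rightarrow> bool" where
  "min_factorisable G S \<longleftrightarrow>
     (\<exists>As. (\<forall>A\<in>set As. A \<subseteq> carrier G) \<and> bij_betw (group_prod G) (listset As) S
           \<and> ls_length As = mls_bound (card S))"

lemma group_prod_Nil [simp]: "group_prod G [] = \<one>\<^bsub>G\<^esub>"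
  and group_prod_Cons [simp]: "group_prod G (x # xs) = x \<otimes>\<^bsub>G\<^esub> group_prod G xs"
  by (simp_all add: group_prod_def)

lemma (in monoid) group_prod_closed:
  "set xs \<subseteq> carrier G \<Longrightarrow> group_prod G xs \<in> carrier G"
  by (induction xs) auto

lemma (in monoid) group_prod_append:
  assumes "set xs \<subseteq> carrier G" "set ys \<subseteq> carrier G"
  shows "group_prod G (xs @ ys) = group_prod G xs \<otimes> group_prod G ys"
  using assms by (induction xs) (auto simp: m_assoc group_prod_closed)

lemma listset_iff_list_all2: "xs \<in> listset As \<longleftrightarrow> list_all2 (\<in>) xs As"
  by (induction As arbitrary: xs) (auto simp: set_Cons_def list_all2_Cons2)

lemma set_subset_if_listset:
  assumes "xs \<in> listset As" "\<forall>A\<in>set As. A \<subseteq> C"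
  shows "set xs \<subseteq> C"
  using assms unfolding listset_iff_list_all2 by (induction rule: list_all2_induct) auto

lemma listset_image: "listset (map ((`) f) As) = map f ` listset As"
proof (induction As)
  case (Cons A As)
  then show ?case by (force simp: set_Cons_def image_iff)
qed simp

lemma bij_betw_listset_append:
  "bij_betw (\<lambda>(xs, ys). xs @ ys) (listset As \<times> listset Bs) (listset (As @ Bs))"
proof (rule bij_betw_imageI)
  show "inj_on (\<lambda>(xs, ys). xs @ ys) (listset As \<times> listset Bs)"
    by (auto simp: inj_on_def listset_iff_list_all2) (metis append_eq_append_conv list_all2_lengthD)+
  show "(\<lambda>(xs, ys). xs @ ys) ` (listset As \<times> listset Bs) = listset (As @ Bs)"
  proof (intro equalityI subsetI)
    fix zs assume "zs \<in> listset (As @ Bs)"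
    then obtain xs ys where "zs = xs @ ys" "xs \<in> listset As" "ys \<in> listset Bs"
      unfolding listset_iff_list_all2 list_all2_append2 by blast
    then show "zs \<in> (\<lambda>(xs, ys). xs @ ys) ` (listset As \<times> listset Bs)" by blast
  qed (auto simp: listset_iff_list_all2 intro: list_all2_appendI)
qed

lemma mls_bound_1: "mls_bound 1 = 0"
  by (simp add: mls_bound_def)

lemma mls_bound_prime: "prime p \<Longrightarrow> mls_bound p = p"
  by (simp add: mls_bound_def prime_factorization_prime)

lemma mls_bound_mult:
  assumes "m > 0" "n > 0"
  shows "mls_bound (m * n) = mls_bound m + mls_bound n"
proof -
  have extend: "mls_bound k = (\<Sum>p\<in>prime_factors (m * n). multiplicity p k * p)"
    if "k dvd m * n" for k
    unfolding mls_bound_def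
  proof (rule sum.mono_neutral_left)
    show "prime_factors k \<subseteq> prime_factors (m * n)" using assms that by (intro dvd_prime_factors) simp_all
    show "\<forall>p\<in>prime_factors (m * n) - prime_factors k. multiplicity p k * p = 0"
      by (auto simp: prime_factors_multiplicity)
  qed simp
  have "mls_bound (m * n) = (\<Sum>p\<in>prime_factors (m * n). multiplicity p m * p + multiplicity p n * p)"
    unfolding mls_bound_def using assms
    by (intro sum.cong refl)
       (auto simp: prime_elem_multiplicity_mult_distrib in_prime_factors_imp_prime add_mult_distrib)
  then show ?thesis by (simp add: extend sum.distrib)
qed

lemma has_MLS_if_min_factorisable:
  assumes "min_factorisable G (carrier G)"
  shows "has_MLS G"
proof -
  obtain As where As: "\<forall>A\<in>set As. A \<subseteq> carrier G" "bij_betw (group_prod G) (listset As) (carrier G)"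
    "ls_length As = mls_bound (card (carrier G))"
    using assms unfolding min_factorisable_def by blast
  have iff: "length xs = length As \<and> (\<forall>i<length As. xs ! i \<in> As ! i) \<longleftrightarrow> xs \<in> listset As" for xs
    by (auto simp: listset_iff_list_all2 list_all2_conv_all_nth)
  have "\<exists>!xs. xs \<in> listset As \<and> group_prod G xs = g" if "g \<in> carrier G" for g
  proof (rule ex_ex1I)
    have "g \<in> group_prod G ` listset As" using bij_betw_imp_surj_on[OF As(2)] that by simp
    then show "\<exists>xs. xs \<in> listset As \<and> group_prod G xs = g" by auto
  qed (use bij_betw_imp_inj_on[OF As(2)] in \<open>auto dest: inj_onD\<close>)
  from this As(1) have "log_signature G As"
    by (simp add: log_signature_def group_prod_def iff flip: conj_assoc)
  then show ?thesis using As(3) unfolding has_MLS_def Coset.order_def by blast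
qed

lemma (in group_hom) hom_group_prod:
  "set xs \<subseteq> carrier G \<Longrightarrow> h (group_prod G xs) = group_prod H (map h xs)"
  by (induction xs) (simp_all add: G.group_prod_closed)

context group
begin

lemma min_factorisable_one: "min_factorisable G {\<one>}"
  unfolding min_factorisable_def
  by (rule exI[of _ "[]"]) (simp add: ls_length_def mls_bound_1[simplified] bij_betw_def)

lemma min_factorisable_prime_card:
  assumes "S \<subseteq> carrier G" "prime (card S)"
  shows "min_factorisable G S"
  unfolding min_factorisable_def
proof (intro exI conjI)
  show "bij_betw (group_prod G) (listset [S]) S"
    using assms(1) by (intro bij_betwI[where g = "\<lambda>x. [x]"]) (auto simp: set_Cons_def)
qed (use assms in \<open>simp_all add: ls_length_def mls_bound_prime\<close>)

lemma min_factorisable_subset: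
  assumes "min_factorisable G S"
  shows "S \<subseteq> carrier G"
proof -
  obtain As where As: "\<forall>A\<in>set As. A \<subseteq> carrier G" "bij_betw (group_prod G) (listset As) S"
    using assms unfolding min_factorisable_def by blast
  have "group_prod G xs \<in> carrier G" if "xs \<in> listset As" for xs
    using set_subset_if_listset[OF that As(1)] by (rule group_prod_closed)
  then show ?thesis using bij_betw_imp_surj_on[OF As(2)] by blast
qed

lemma min_factorisable_set_mult:
  assumes S: "min_factorisable G S" and T: "min_factorisable G T"
    and card: "card S > 0" "card T > 0"
    and inj: "inj_on (\<lambda>(s, t). s \<otimes> t) (S \<times> T)"
  shows "min_factorisable G (S <#> T)"
proof -
  obtain As where As: "\<forall>A\<in>set As. A \<subseteq> carrier G" "bij_betw (group_prod G) (listset As) S"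
    "ls_length As = mls_bound (card S)"
    using S unfolding min_factorisable_def by blast
  obtain Bs where Bs: "\<forall>A\<in>set Bs. A \<subseteq> carrier G" "bij_betw (group_prod G) (listset Bs) T"
    "ls_length Bs = mls_bound (card T)"
    using T unfolding min_factorisable_def by blast
  have ST: "bij_betw (\<lambda>(s, t). s \<otimes> t) (S \<times> T) (S <#> T)"
    using inj by (auto simp: bij_betw_def set_mult_def)
  have "bij_betw (map_prod (group_prod G) (group_prod G)) (listset As \<times> listset Bs) (S \<times> T)"
    using As(2) Bs(2) by (simp add: bij_betw_def map_prod_surj_on map_prod_inj_on)
  then have "bij_betw ((\<lambda>(s, t). s \<otimes> t) \<circ> map_prod (group_prod G) (group_prod G))
      (listset As \<times> listset Bs) (S <#> T)"
    using ST by (rule bij_betw_trans)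
  moreover have "group_prod G (xs @ ys) = group_prod G xs \<otimes> group_prod G ys"
    if "xs \<in> listset As" "ys \<in> listset Bs" for xs ys
    using that As(1) Bs(1) by (intro group_prod_append set_subset_if_listset)
  ultimately have "bij_betw (group_prod G \<circ> (\<lambda>(xs, ys). xs @ ys)) (listset As \<times> listset Bs) (S <#> T)"
    by (subst bij_betw_cong) auto
  then have "bij_betw (group_prod G) (listset (As @ Bs)) (S <#> T)"
    using bij_betw_comp_iff[OF bij_betw_listset_append] by blast
  moreover have "ls_length (As @ Bs) = mls_bound (card (S <#> T))"
    using As(3) Bs(3) card bij_betw_same_card[OF ST, symmetric]
    by (simp add: ls_length_def card_cartesian_product mls_bound_mult)
  ultimately show ?thesis
    using As(1) Bs(1) unfolding min_factorisable_def by (intro exI[of _ "As @ Bs"]) auto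
qed

lemma min_factorisable_if_section:
  assumes fin: "finite (carrier G)" and L: "subgroup L G"
    and S: "min_factorisable G S" "S \<subseteq> L" and K: "min_factorisable G K" "K \<subseteq> L"
    and bij: "bij_betw f S (f ` L)"
    and fibre: "\<And>g h. g \<in> L \<Longrightarrow> h \<in> L \<Longrightarrow> f g = f h \<longleftrightarrow> inv g \<otimes> h \<in> K"
  shows "min_factorisable G L"
proof -
  note LG = subgroup.mem_carrier[OF L]
  have cancel: "inv s \<otimes> (s \<otimes> k) = k" if "s \<in> S" "k \<in> K" for s k
    using that S(2) K(2) LG by (simp add: subset_iff flip: m_assoc)
  have f_mult: "f s = f (s \<otimes> k)" if "s \<in> S" "k \<in> K" for s k
    using fibre[of s "s \<otimes> k"] that cancel S(2) K(2) subgroup.m_closed[OF L] by (simp add: subset_iff)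
  have inj: "inj_on (\<lambda>(s, k). s \<otimes> k) (S \<times> K)"
  proof (intro inj_onI, clarify)
    fix s k t l assume eq: "s \<in> S" "k \<in> K" "t \<in> S" "l \<in> K" "s \<otimes> k = t \<otimes> l"
    then have "f s = f t" using f_mult by metis
    then have "s = t" using bij eq by (meson bij_betw_imp_inj_on inj_onD)
    then show "s = t \<and> k = l" using eq cancel by metis
  qed
  have "g \<in> S <#> K" if g: "g \<in> L" for g
  proof -
    obtain s where s: "s \<in> S" "f s = f g" using bij g unfolding bij_betw_def by (metis imageE imageI)
    then have "inv s \<otimes> g \<in> K" using fibre S(2) g by blast
    moreover have "g = s \<otimes> (inv s \<otimes> g)" using s S(2) g LG by (simp add: subset_iff flip: m_assoc)
    ultimately show ?thesis using s(1) unfolding set_mult_def by blast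
  qed
  then have "S <#> K = L" using S(2) K(2) subgroup.m_closed[OF L] unfolding set_mult_def by blast
  moreover have "finite S" "finite K" using fin subgroup.subset[OF L] S(2) K(2) by (meson finite_subset)+
  moreover have "S \<noteq> {}" "K \<noteq> {}" using \<open>S <#> K = L\<close> subgroup.one_closed[OF L] by (auto simp: set_mult_def)
  ultimately show ?thesis using min_factorisable_set_mult[OF S(1) K(1) _ _ inj] by (simp add: card_gt_0_iff)
qed

lemma min_factorisable_lift:
  assumes H: "group H" and hom: "h \<in> hom G H" and surj: "h ` carrier G = carrier H"
    and T: "min_factorisable H T"
  obtains S where "min_factorisable G S" "bij_betw h S T"
proof -
  obtain As where As: "\<forall>A\<in>set As. A \<subseteq> carrier H" "bij_betw (group_prod H) (listset As) T"
    "ls_length As = mls_bound (card T)"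
    using T unfolding min_factorisable_def by blast
  define s where "s = inv_into (carrier G) h"
  have s: "s x \<in> carrier G" "h (s x) = x" if "x \<in> carrier H" for x
    using that surj unfolding s_def by (auto simp: inv_into_into f_inv_into_f)
  interpret h: group_hom G H h
    using H hom by (simp add: group_hom_def group_hom_axioms_def is_group)
  have h_prod: "h (group_prod G (map s xs)) = group_prod H xs" if "set xs \<subseteq> carrier H" for xs
  proof -
    have "map h (map s xs) = xs" using that s(2) by (simp add: map_idI subset_iff)
    moreover have "set (map s xs) \<subseteq> carrier G" using that s(1) by auto
    ultimately show ?thesis by (metis h.hom_group_prod)
  qed
  define S where "S = group_prod G ` map s ` listset As"
  have comp: "bij_betw (h \<circ> (group_prod G \<circ> map s)) (listset As) T"
    using As(2) h_prod[OF set_subset_if_listset[OF _ As(1)]] by (auto cong: bij_betw_cong)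
  then have "inj_on (group_prod G \<circ> map s) (listset As)"
    unfolding bij_betw_def by (blast intro: inj_on_imageI2)
  then have "bij_betw (group_prod G \<circ> map s) (listset As) S"
    and prods: "bij_betw (group_prod G) (map s ` listset As) S"
    by (auto simp: S_def bij_betw_def image_comp inj_on_imageI)
  then have bij: "bij_betw h S T" using bij_betw_comp_iff comp by blast
  have "card (s ` A) = card A" if "A \<in> set As" for A
    using that As(1) s(2) by (intro card_image inj_onI) (metis subsetD)
  then have "ls_length (map ((`) s) As) = mls_bound (card S)"
    using As(3) bij_betw_same_card[OF bij] by (simp add: ls_length_def comp_def cong: map_cong)
  then have "min_factorisable G S"
    unfolding min_factorisable_def using prods As(1) s(1)
    by (intro exI[of _ "map ((`) s) As"]) (auto simp: listset_image)
  then show ?thesis using bij that by blast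
qed

end

lemma min_factorisable_carrier_mono:
  assumes "min_factorisable (G\<lparr>carrier := H\<rparr>) S" "H \<subseteq> carrier G"
  shows "min_factorisable G S"
  using assms unfolding min_factorisable_def group_prod_def by fastforce

lemma (in group) min_factorisable_iso:
  assumes "group H" "h \<in> iso G H" "min_factorisable H (carrier H)"
  shows "min_factorisable G (carrier G)"
proof -
  have h: "h \<in> hom G H" "bij_betw h (carrier G) (carrier H)" using assms(2) by (auto simp: iso_def)
  obtain S where S: "min_factorisable G S" "bij_betw h S (carrier H)"
    using min_factorisable_lift[OF assms(1) h(1) _ assms(3)] h(2) by (auto simp: bij_betw_def)
  have "S = carrier G"
    using h(2) S(2) min_factorisable_subset[OF S(1)] unfolding bij_betw_def
    by (metis inj_on_image_eq_iff subset_refl)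
  then show ?thesis using S(1) by simp
qed

section \<open>Finite solvable groups\<close>

lemma (in group) group_hom_restrict:
  assumes "subgroup K G" "group H" "h \<in> hom (G\<lparr>carrier := K\<rparr>) H"
  shows "group_hom (G\<lparr>carrier := K\<rparr>) H h"
  using assms subgroup_imp_group by (simp add: group_hom_def group_hom_axioms_def)

lemma (in group) min_factorisable_extension:
  assumes fin: "finite (carrier G)" and L: "subgroup L G" and H: "group H"
    and hom: "h \<in> hom (G\<lparr>carrier := L\<rparr>) H" and surj: "h ` L = carrier H"
    and quot: "min_factorisable H (carrier H)" and ker: "min_factorisable G {x\<in>L. h x = \<one>\<^bsub>H\<^esub>}"
  shows "min_factorisable G L"
proof -
  interpret h: group_hom "G\<lparr>carrier := L\<rparr>" H h by (rule group_hom_restrict[OF L H hom])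
  obtain S where S: "min_factorisable (G\<lparr>carrier := L\<rparr>) S" "bij_betw h S (h ` L)"
    using h.G.min_factorisable_lift[OF H hom _ quot] surj by auto
  show ?thesis
  proof (rule min_factorisable_if_section[OF fin L _ _ ker _ S(2)])
    show "min_factorisable G S"
      using S(1) subgroup.subset[OF L] by (rule min_factorisable_carrier_mono)
    show "S \<subseteq> L" using h.G.min_factorisable_subset[OF S(1)] by simp
    fix g k assume gk: "g \<in> L" "k \<in> L"
    then have "h (inv g \<otimes> k) = inv\<^bsub>H\<^esub> h g \<otimes>\<^bsub>H\<^esub> h k"
      using h.hom_mult[of "inv g" k] h.hom_inv[of g] L by (simp add: subgroup.m_inv_closed)
    then have "h (inv g \<otimes> k) = \<one>\<^bsub>H\<^esub> \<longleftrightarrow> h k = h g"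
      using gk h.hom_closed by (simp add: h.H.inv_solve_left')
    then show "h g = h k \<longleftrightarrow> inv g \<otimes> k \<in> {x\<in>L. h x = \<one>\<^bsub>H\<^esub>}"
      using gk L by (auto simp: subgroup.m_closed subgroup.m_inv_closed)
  qed auto
qed

lemma (in group) exists_prime_ord:
  assumes "finite (carrier G)" "x \<in> carrier G" "x \<noteq> \<one>"
  shows "\<exists>y\<in>carrier G. prime (ord y)"
proof -
  have "ord x \<noteq> 1" using assms(2,3) ord_eq_1 by blast
  then obtain p where p: "prime p" "p dvd ord x" using prime_factor_nat by blast
  have "ord x > 0" using ord_ge_1[OF assms(1,2)] by simp
  then have "ord (x [^] (ord x div p)) = p"
    using p assms(2) by (subst ord_pow) (auto elim!: dvdE)
  then show ?thesis using p(1) assms(2) by (metis nat_pow_closed)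
qed

lemma (in group) min_factorisable_if_quotient:
  assumes fin: "finite (carrier G)" and L: "subgroup L G" and K: "K \<lhd> G\<lparr>carrier := L\<rparr>"
    and "min_factorisable G K"
    and quot: "min_factorisable (G\<lparr>carrier := L\<rparr> Mod K) (carrier (G\<lparr>carrier := L\<rparr> Mod K))"
  shows "min_factorisable G L"
proof -
  interpret L: group "G\<lparr>carrier := L\<rparr>" by (rule subgroup_imp_group[OF L])
  interpret K: normal K "G\<lparr>carrier := L\<rparr>" by (rule K)
  show ?thesis
  proof (rule min_factorisable_extension[OF fin L K.factorgroup_is_group K.r_coset_hom_Mod _ quot])
    have "{x\<in>L. K #>\<^bsub>G\<lparr>carrier := L\<rparr>\<^esub> x = K} = K"
      using K.subset L.coset_join1[OF _ _ K.subgroup_axioms] L.coset_join2[OF _ K.subgroup_axioms] by auto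
    then show "min_factorisable G {x\<in>L. K #>\<^bsub>G\<lparr>carrier := L\<rparr>\<^esub> x = \<one>\<^bsub>G\<lparr>carrier := L\<rparr> Mod K\<^esub>}"
      using assms(4) by simp
  qed (auto simp: FactGroup_def RCOSETS_def)
qed

lemma (in group_hom) subgroup_preimage:
  assumes "subgroup C H"
  shows "subgroup {g\<in>carrier G. h g \<in> C} G"
  using subgroup.one_closed[OF assms] subgroup.m_closed[OF assms] subgroup.m_inv_closed[OF assms]
  by (intro G.subgroupI) auto

lemma (in group_hom) min_factorisable_preimage:
  assumes fin: "finite (carrier G)" and C: "subgroup C H" "C \<subseteq> h ` carrier G"
    and "min_factorisable (H\<lparr>carrier := C\<rparr>) C" "min_factorisable G (kernel G H h)"
  shows "min_factorisable G {g\<in>carrier G. h g \<in> C}"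
proof (rule G.min_factorisable_extension[OF fin subgroup_preimage[OF C(1)] H.subgroup_imp_group[OF C(1)]])
  have "{g\<in>{g\<in>carrier G. h g \<in> C}. h g = \<one>\<^bsub>H\<^esub>} = kernel G H h"
    using subgroup.one_closed[OF C(1)] by (auto simp: kernel_def)
  then show "min_factorisable G {g\<in>{g\<in>carrier G. h g \<in> C}. h g = \<one>\<^bsub>H\<lparr>carrier := C\<rparr>\<^esub>}"
    using assms(5) by simp
qed (use assms in \<open>auto simp: hom_def\<close>)

lemma (in comm_group) min_factorisable_proper_extension:
  assumes fin: "finite (carrier G)" and K: "subgroup K G" "min_factorisable G K" "K \<noteq> carrier G"
  obtains L where "subgroup L G" "min_factorisable G L" "K \<subset> L"
proof -
  interpret K: normal K G using K(1) by (rule subgroup_imp_normal)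
  interpret quot: group_hom G "G Mod K" "\<lambda>g. K #> g"
    using K.factorgroup_is_group K.r_coset_hom_Mod by (simp add: group_hom_def group_hom_axioms_def is_group)
  have ker: "K #> g = K \<longleftrightarrow> g \<in> K" if "g \<in> carrier G" for g
    using coset_join1[OF _ that K(1)] coset_join2[OF that K(1)] by blast
  obtain x where "x \<in> carrier G" "x \<notin> K" using K(3) K.subset by blast
  then have "K #> x \<in> carrier (G Mod K)" "K #> x \<noteq> \<one>\<^bsub>G Mod K\<^esub>" using ker by simp_all
  moreover have "finite (carrier (G Mod K))" using fin by (auto simp: FactGroup_def RCOSETS_def)
  ultimately obtain Y where Y: "Y \<in> carrier (G Mod K)" "prime (quot.H.ord Y)"
    using quot.H.exists_prime_ord by blast
  then obtain y where y: "y \<in> carrier G" "Y = K #> y" by (auto simp: FactGroup_def RCOSETS_def)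
  define C where "C = generate (G Mod K) {Y}"
  have C: "subgroup C (G Mod K)" unfolding C_def using Y(1) by (intro quot.H.generate_is_subgroup) simp
  define L where "L = {g\<in>carrier G. K #> g \<in> C}"
  have "min_factorisable G L"
    unfolding L_def
  proof (rule quot.min_factorisable_preimage[OF fin C])
    show "C \<subseteq> (\<lambda>g. K #> g) ` carrier G"
      using subgroup.subset[OF C] by (auto simp: FactGroup_def RCOSETS_def)
    have "prime (card C)" unfolding C_def using Y quot.H.generate_pow_card by metis
    then show "min_factorisable ((G Mod K)\<lparr>carrier := C\<rparr>) C"
      using quot.H.subgroup_imp_group[OF C] by (intro group.min_factorisable_prime_card) auto
    have "kernel G (G Mod K) (\<lambda>g. K #> g) = K" using ker K.subset by (auto simp: kernel_def)
    then show "min_factorisable G (kernel G (G Mod K) (\<lambda>g. K #> g))" using K(2) by simp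
  qed
  moreover have "subgroup L G" unfolding L_def using C by (rule quot.subgroup_preimage)
  moreover have "K \<subset> L"
  proof
    show "K \<subseteq> L" using coset_join2[OF _ K(1)] K.subset subgroup.one_closed[OF C] by (auto simp: L_def)
    have "Y \<noteq> \<one>\<^bsub>G Mod K\<^esub>" using Y(2) quot.H.ord_id by auto
    then have "y \<notin> K" using ker y by simp
    moreover have "y \<in> L" using y by (auto simp: L_def C_def intro: generate.incl)
    ultimately show "K \<noteq> L" by blast
  qed
  ultimately show ?thesis using that by blast
qed

lemma (in comm_group) min_factorisable_comm_group:
  assumes fin: "finite (carrier G)"
  shows "min_factorisable G (carrier G)"
proof -
  define \<K> where "\<K> = {K. subgroup K G \<and> min_factorisable G K}"
  have "\<K> \<subseteq> Pow (carrier G)" using subgroup.subset unfolding \<K>_def by blast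
  then have "finite \<K>" using fin by (meson finite_Pow_iff finite_subset)
  moreover have "{\<one>} \<in> \<K>" using min_factorisable_one triv_subgroup by (simp add: \<K>_def)
  ultimately obtain K where K: "K \<in> \<K>" and max: "\<And>L. L \<in> \<K> \<Longrightarrow> K \<subseteq> L \<Longrightarrow> L = K"
    using finite_has_maximal[of \<K>] by blast
  have "K = carrier G"
  proof (rule ccontr)
    assume "K \<noteq> carrier G"
    moreover have "subgroup K G" "min_factorisable G K" using K by (simp_all add: \<K>_def)
    ultimately obtain L where "subgroup L G" "min_factorisable G L" "K \<subset> L"
      using min_factorisable_proper_extension[OF fin] by blast
    then show False using max[of L] by (simp add: \<K>_def psubset_eq)
  qed
  then show ?thesis using K by (simp add: \<K>_def)
qed

lemma (in group) min_factorisable_cyclic: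
  assumes "finite (carrier G)" "x \<in> carrier G"
  shows "min_factorisable G (generate G {x})"
proof (rule min_factorisable_carrier_mono)
  show sub: "generate G {x} \<subseteq> carrier G" using assms(2) by (intro generate_incl) simp
  have "subgroup_generated G {x} = G\<lparr>carrier := generate G {x}\<rparr>"
    using assms(2) by (simp add: subgroup_generated_def)
  then have "comm_group (G\<lparr>carrier := generate G {x}\<rparr>)"
    using group.cyclic_imp_abelian_group[OF group_subgroup_generated cyclic_group_generated[of x]] by simp
  then show "min_factorisable (G\<lparr>carrier := generate G {x}\<rparr>) (generate G {x})"
    using comm_group.min_factorisable_comm_group assms(1) finite_subset[OF sub] by fastforce
qed

theorem (in group) min_factorisable_if_solvable_seq:
  assumes "solvable_seq G L" "finite (carrier G)"
  shows "min_factorisable G L"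
  using assms(1)
proof induction
  case unity
  show ?case by (rule min_factorisable_one)
next
  case (extension K L)
  have "finite (carrier (G\<lparr>carrier := L\<rparr> Mod K))"
    using assms(2) subgroup.subset[OF extension.hyps(3)] by (auto simp: FactGroup_def RCOSETS_def finite_subset)
  then have "min_factorisable (G\<lparr>carrier := L\<rparr> Mod K) (carrier (G\<lparr>carrier := L\<rparr> Mod K))"
    by (rule comm_group.min_factorisable_comm_group[OF extension.hyps(4)])
  with assms(2) extension.hyps(3,2) extension.IH show ?case by (rule min_factorisable_if_quotient)
qed

corollary (in group) min_factorisable_if_solvable_subgroup:
  assumes "subgroup K G" "solvable (G\<lparr>carrier := K\<rparr>)" "finite (carrier G)"
  shows "min_factorisable G K"
proof (rule min_factorisable_carrier_mono)
  show "K \<subseteq> carrier G" using assms(1) by (rule subgroup.subset)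
  then have "finite (carrier (G\<lparr>carrier := K\<rparr>))" using assms(3) by (simp add: finite_subset)
  then show "min_factorisable (G\<lparr>carrier := K\<rparr>) K"
    using assms(2) subgroup_imp_group[OF assms(1)] group.min_factorisable_if_solvable_seq
    by (fastforce simp: solvable_def)
qed

lemma (in comm_group) solvable_comm_group: "solvable G"
proof -
  have "derived G (carrier G) = {\<one>}" by (intro derived_eq_singleton) simp
  then show ?thesis
    using augment_solvable_seq[OF subgroup_self] unity[of G] by (simp add: solvable_def)
qed

lemma (in group_hom) solvable_if_solvable_kernel:
  assumes "comm_group H" "solvable (G\<lparr>carrier := kernel G H h\<rparr>)"
  shows "solvable G"
  unfolding solvable_def
proof (rule solvable_seq_condition)
  show "group_hom (G\<lparr>carrier := kernel G H h\<rparr>) G (\<lambda>x. x)"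
    using G.subgroup_imp_group[OF subgroup_kernel]
    by (auto simp: group_hom_def group_hom_axioms_def hom_def kernel_def)
  show "group_hom G H h" by (rule group_hom_axioms)
  show "solvable_seq H (h ` carrier G)"
    using comm_group.solvable_comm_group[OF assms(1)] by (rule H.solvable_subgroup[OF img_is_subgroup])
  show "solvable_seq (G\<lparr>carrier := kernel G H h\<rparr>) (kernel G H h)"
    using assms(2) by (simp add: solvable_def)
qed (auto simp: kernel_def G.subgroup_self)

lemma (in group) subgroup_kernel_restrict:
  assumes "subgroup K G" "group H" "h \<in> hom (G\<lparr>carrier := K\<rparr>) H"
  shows "subgroup {x\<in>K. h x = \<one>\<^bsub>H\<^esub>} G"
  using incl_subgroup[OF assms(1) group_hom.subgroup_kernel[OF group_hom_restrict[OF assms]]]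
  by (simp add: kernel_def)

lemma (in group) solvable_if_solvable_kernel_restrict:
  assumes "subgroup K G" "comm_group H" "h \<in> hom (G\<lparr>carrier := K\<rparr>) H"
    and "solvable (G\<lparr>carrier := {x\<in>K. h x = \<one>\<^bsub>H\<^esub>}\<rparr>)"
  shows "solvable (G\<lparr>carrier := K\<rparr>)"
  using group_hom.solvable_if_solvable_kernel[OF group_hom_restrict[OF assms(1) _ assms(3)] assms(2)]
    assms(4) comm_group.axioms(2)[OF assms(2)] by (simp add: kernel_def)

section \<open>Group actions and tilings\<close>

definition tiling :: "('g \<Rightarrow> 'w \<Rightarrow> 'w) \<Rightarrow> 'g set \<Rightarrow> 'w set \<Rightarrow> 'w set \<Rightarrow> bool" where
  "tiling \<phi> A P Q \<longleftrightarrow> bij_betw (\<lambda>(g, x). \<phi> g x) (A \<times> P) Q"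

definition min_tiles :: "('g, 'b) monoid_scheme \<Rightarrow> ('g \<Rightarrow> 'w \<Rightarrow> 'w) \<Rightarrow> 'w set \<Rightarrow> 'w set \<Rightarrow> bool" where
  "min_tiles G \<phi> P Q \<longleftrightarrow> (\<exists>A. min_factorisable G A \<and> tiling \<phi> A P Q)"

lemma tiling_singleton_iff: "tiling \<phi> A {x} Q \<longleftrightarrow> bij_betw (\<lambda>g. \<phi> g x) A Q"
proof -
  have "bij_betw (\<lambda>g. (g, x)) A (A \<times> {x})" by (rule bij_betwI[where g = fst]) auto
  then show ?thesis
    using bij_betw_comp_iff[of "\<lambda>g. (g, x)" A "A \<times> {x}" "\<lambda>(g, x). \<phi> g x" Q]
    by (simp add: tiling_def comp_def)
qed

lemma tiling_imp_inj:
  assumes "tiling \<phi> A P Q" "g \<in> A" "h \<in> A" "x \<in> P" "y \<in> P" "\<phi> g x = \<phi> h y"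
  shows "g = h \<and> x = y"
  using inj_onD[OF bij_betw_imp_inj_on[OF assms(1)[unfolded tiling_def]], of "(g, x)" "(h, y)"] assms(2-)
  by simp

lemma tiling_imp_surj:
  assumes "tiling \<phi> A P Q" "z \<in> Q"
  obtains g x where "g \<in> A" "x \<in> P" "\<phi> g x = z"
proof -
  have "z \<in> (\<lambda>(g, x). \<phi> g x) ` (A \<times> P)" using assms unfolding tiling_def bij_betw_def by simp
  then show ?thesis using that by auto
qed

lemma tiling_closed:
  assumes "tiling \<phi> A P Q" "g \<in> A" "x \<in> P"
  shows "\<phi> g x \<in> Q"
  using bij_betw_apply[OF assms(1)[unfolded tiling_def], of "(g, x)"] assms(2,3) by simp

lemma tilingI:
  assumes "\<And>g x. g \<in> A \<Longrightarrow> x \<in> P \<Longrightarrow> \<phi> g x \<in> Q"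
    and "\<And>z. z \<in> Q \<Longrightarrow> \<exists>g\<in>A. \<exists>x\<in>P. \<phi> g x = z"
    and "\<And>g h x y. g \<in> A \<Longrightarrow> h \<in> A \<Longrightarrow> x \<in> P \<Longrightarrow> y \<in> P \<Longrightarrow> \<phi> g x = \<phi> h y \<Longrightarrow> g = h \<and> x = y"
  shows "tiling \<phi> A P Q"
  unfolding tiling_def
proof (rule bij_betw_imageI)
  show "inj_on (\<lambda>(g, x). \<phi> g x) (A \<times> P)" using assms(3) by (auto simp: inj_on_def)
  show "(\<lambda>(g, x). \<phi> g x) ` (A \<times> P) = Q" using assms(1,2) by (force simp: image_iff)
qed

lemma tiling_Un:
  assumes "tiling \<phi> A P Q" "tiling \<phi> A P' Q'" "Q \<inter> Q' = {}"
  shows "tiling \<phi> A (P \<union> P') (Q \<union> Q')"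
  using assms bij_betw_combine unfolding tiling_def Sigma_Un_distrib2 by blast

context group_action
begin

lemma is_group: "group G"
  using group_hom by (rule group_hom.axioms(1))

lemma one_acts: "x \<in> E \<Longrightarrow> \<phi> \<one> x = x"
  using id_eq_one by (metis restrict_apply')

lemma act_eq_iff:
  assumes "g \<in> carrier G" "h \<in> carrier G" "x \<in> E"
  shows "\<phi> g x = \<phi> h x \<longleftrightarrow> inv g \<otimes> h \<in> stabilizer G \<phi> x"
proof -
  interpret group G by (rule is_group)
  have "\<phi> (inv g) (\<phi> g x) = x" using assms by (intro orbit_sym_aux) auto
  moreover have "inj_on (\<phi> (inv g)) E" "\<phi> g x \<in> E" "\<phi> h x \<in> E"
    using assms by (auto intro: inj_prop element_image)
  ultimately have "\<phi> g x = \<phi> h x \<longleftrightarrow> x = \<phi> (inv g) (\<phi> h x)" by (metis inj_onD)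
  then show ?thesis using assms by (auto simp: stabilizer_def composition_rule)
qed

lemma tiling_mult:
  assumes sub: "A \<subseteq> carrier G" "B \<subseteq> carrier G" "P \<subseteq> E" and "P \<noteq> {}"
    and B: "tiling \<phi> B P Q" and A: "tiling \<phi> A Q R"
  shows "inj_on (\<lambda>(a, b). a \<otimes> b) (A \<times> B)" "tiling \<phi> (A <#> B) P R"
proof -
  have comp: "\<phi> (a \<otimes> b) x = \<phi> a (\<phi> b x)" if "a \<in> A" "b \<in> B" "x \<in> P" for a b x
    using that sub by (intro composition_rule) auto
  have unique: "a = a' \<and> b = b' \<and> x = x'"
    if eq: "a \<in> A" "b \<in> B" "x \<in> P" "a' \<in> A" "b' \<in> B" "x' \<in> P" "\<phi> (a \<otimes> b) x = \<phi> (a' \<otimes> b') x'"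
    for a b x a' b' x'
  proof -
    have "\<phi> a (\<phi> b x) = \<phi> a' (\<phi> b' x')" using eq comp by simp
    then have "a = a' \<and> \<phi> b x = \<phi> b' x'"
      using eq by (intro tiling_imp_inj[OF A] tiling_closed[OF B])
    then show ?thesis using tiling_imp_inj[OF B] eq by blast
  qed
  show "inj_on (\<lambda>(a, b). a \<otimes> b) (A \<times> B)"
  proof (intro inj_onI, clarify)
    fix a b a' b' assume eq: "a \<in> A" "b \<in> B" "a' \<in> A" "b' \<in> B" "a \<otimes> b = a' \<otimes> b'"
    obtain x where "x \<in> P" using \<open>P \<noteq> {}\<close> by blast
    then show "a = a' \<and> b = b'" using unique[of a b x a' b' x] eq by simp
  qed
  show "tiling \<phi> (A <#> B) P R"
  proof (rule tilingI)
    fix z assume "z \<in> R"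
    then obtain a y where a: "a \<in> A" "y \<in> Q" "\<phi> a y = z" using tiling_imp_surj[OF A] by blast
    obtain b x where "b \<in> B" "x \<in> P" "\<phi> b x = y" using tiling_imp_surj[OF B a(2)] by blast
    then show "\<exists>g\<in>A <#> B. \<exists>x\<in>P. \<phi> g x = z" using a comp unfolding set_mult_def by force
  next
    fix g x assume "g \<in> A <#> B" "x \<in> P"
    then show "\<phi> g x \<in> R"
      using tiling_closed[OF A] tiling_closed[OF B] by (auto simp: set_mult_def comp)
  qed (auto simp: set_mult_def dest: unique)
qed

lemma tiling_subset_orbit:
  assumes "tiling \<phi> A P Q" "A \<subseteq> carrier G" "P \<subseteq> orbit G \<phi> x" "x \<in> E"
  shows "Q \<subseteq> orbit G \<phi> x"
proof
  interpret group G by (rule is_group)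
  fix z assume "z \<in> Q"
  then obtain g y where "g \<in> A" "y \<in> P" "\<phi> g y = z" using tiling_imp_surj[OF assms(1)] by blast
  moreover obtain h where "h \<in> carrier G" "y = \<phi> h x" using \<open>y \<in> P\<close> assms(3) by (auto simp: orbit_def)
  ultimately show "z \<in> orbit G \<phi> x"
    using assms(2,4) by (auto simp: orbit_def composition_rule intro!: exI[of _ "g \<otimes> h"])
qed

lemma min_tiles_trans:
  assumes "min_tiles G \<phi> P Q" "min_tiles G \<phi> Q R" "finite (carrier G)" "P \<subseteq> E" "P \<noteq> {}" "R \<noteq> {}"
  shows "min_tiles G \<phi> P R"
proof -
  interpret group G by (rule is_group)
  obtain A B where A: "min_factorisable G A" "tiling \<phi> A Q R" and B: "min_factorisable G B" "tiling \<phi> B P Q"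
    using assms(1,2) unfolding min_tiles_def by blast
  note sub = min_factorisable_subset[OF A(1)] min_factorisable_subset[OF B(1)]
  note mult = tiling_mult[OF sub assms(4,5) B(2) A(2)]
  have "A \<noteq> {}" "B \<noteq> {}" using A(2) B(2) \<open>R \<noteq> {}\<close> by (auto simp: tiling_def bij_betw_def)
  moreover have "finite A" "finite B" using sub assms(3) by (auto intro: finite_subset)
  ultimately have "min_factorisable G (A <#> B)"
    using min_factorisable_set_mult[OF A(1) B(1) _ _ mult(1)] by (simp add: card_gt_0_iff)
  then show ?thesis using mult(2) unfolding min_tiles_def by blast
qed

lemma min_tiles_prime_card:
  assumes "P \<subseteq> orbit G \<phi> x" "prime (card P)"
  shows "min_tiles G \<phi> {x} P"
proof -
  have "\<forall>y\<in>P. \<exists>g\<in>carrier G. \<phi> g x = y" using assms(1) by (auto simp: orbit_def)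
  then obtain g where g: "\<And>y. y \<in> P \<Longrightarrow> g y \<in> carrier G \<and> \<phi> (g y) x = y" by metis
  have bij: "bij_betw (\<lambda>h. \<phi> h x) (g ` P) P"
    using g by (intro bij_betwI[where g = g]) auto
  then have "min_factorisable G (g ` P)"
    using g assms(2) bij_betw_same_card[OF bij]
    by (intro group.min_factorisable_prime_card is_group) auto
  then show ?thesis using bij unfolding min_tiles_def tiling_singleton_iff by blast
qed

theorem min_factorisable_if_min_tiles_orbit:
  assumes "finite (carrier G)" "x \<in> E" "min_tiles G \<phi> {x} (orbit G \<phi> x)"
    and "min_factorisable G (stabilizer G \<phi> x)"
  shows "min_factorisable G (carrier G)"
proof -
  interpret group G by (rule is_group)
  obtain S where S: "min_factorisable G S" "bij_betw (\<lambda>g. \<phi> g x) S (orbit G \<phi> x)"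
    using assms(3) unfolding min_tiles_def tiling_singleton_iff by blast
  show ?thesis
  proof (rule min_factorisable_if_section[OF assms(1) subgroup_self S(1) _ assms(4)])
    show "S \<subseteq> carrier G" by (rule min_factorisable_subset[OF S(1)])
    show "stabilizer G \<phi> x \<subseteq> carrier G" by (rule stabilizer_subset)
    have "(\<lambda>g. \<phi> g x) ` carrier G = orbit G \<phi> x" by (auto simp: orbit_def)
    then show "bij_betw (\<lambda>g. \<phi> g x) S ((\<lambda>g. \<phi> g x) ` carrier G)" using S(2) by simp
  qed (use act_eq_iff assms(2) in blast)
qed

end

locale semiregular_subgroup = group_action G E \<phi> for G (structure) and E :: "'w set" and \<phi> +
  fixes C \<Omega>
  assumes subgroup: "subgroup C G" and \<Omega>_subset: "\<Omega> \<subseteq> E" and finite_\<Omega>: "finite \<Omega>"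
    and \<Omega>_invariant: "\<And>g x. g \<in> C \<Longrightarrow> x \<in> \<Omega> \<Longrightarrow> \<phi> g x \<in> \<Omega>"
    and semiregular: "\<And>g x. g \<in> C \<Longrightarrow> x \<in> \<Omega> \<Longrightarrow> \<phi> g x = x \<Longrightarrow> g = \<one>"
begin

interpretation C: group_action "G\<lparr>carrier := C\<rparr>" E \<phi>
  using subgroup by (rule induced_action)

lemma semiregular_unique:
  assumes "g \<in> C" "h \<in> C" "x \<in> \<Omega>" "\<phi> g x = \<phi> h x"
  shows "g = h"
proof -
  interpret group G by (rule is_group)
  have gh: "g \<in> carrier G" "h \<in> carrier G" using assms subgroup.mem_carrier[OF subgroup] by auto
  then have "\<phi> (inv g \<otimes> h) x = x" using act_eq_iff assms(3,4) \<Omega>_subset by (auto simp: stabilizer_def)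
  then have "inv g \<otimes> h = \<one>"
    using semiregular assms subgroup by (simp add: subgroup.m_closed subgroup.m_inv_closed)
  then show ?thesis using gh by (simp add: inv_solve_left')
qed

lemma tiling_semiregular:
  assumes R: "R \<subseteq> \<Omega>" "\<And>x. x \<in> \<Omega> \<Longrightarrow> \<exists>!y. y \<in> R \<inter> orbit (G\<lparr>carrier := C\<rparr>) \<phi> x"
  shows "tiling \<phi> C R \<Omega>"
proof (rule tilingI)
  have orbit_back: "x \<in> orbit (G\<lparr>carrier := C\<rparr>) \<phi> (\<phi> g x)" if "g \<in> C" "x \<in> \<Omega>" for g x
  proof -
    have "\<phi> g x \<in> orbit (G\<lparr>carrier := C\<rparr>) \<phi> x" using that(1) by (auto simp: orbit_def)
    then show ?thesis using C.orbit_sym[of x "\<phi> g x"] \<Omega>_subset \<Omega>_invariant that by blast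
  qed
  show "\<phi> g x \<in> \<Omega>" if "g \<in> C" "x \<in> R" for g x using that R(1) \<Omega>_invariant by blast
  show "\<exists>g\<in>C. \<exists>x\<in>R. \<phi> g x = z" if z: "z \<in> \<Omega>" for z
  proof -
    obtain x where x: "x \<in> R" "x \<in> orbit (G\<lparr>carrier := C\<rparr>) \<phi> z" using R(2)[OF z] by blast
    then have "z \<in> orbit (G\<lparr>carrier := C\<rparr>) \<phi> x" using z R(1) \<Omega>_subset C.orbit_sym[OF _ _ x(2)] by blast
    then show ?thesis using x(1) by (auto simp: orbit_def)
  qed
  show "g = h \<and> x = y" if eq: "g \<in> C" "h \<in> C" "x \<in> R" "y \<in> R" "\<phi> g x = \<phi> h y" for g h x y
  proof -
    have xy: "x \<in> \<Omega>" "y \<in> \<Omega>" using eq R(1) by auto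
    then have "x = y"
      using orbit_back[OF eq(1) xy(1)] orbit_back[OF eq(2) xy(2)] R(2)[OF \<Omega>_invariant[OF eq(1) xy(1)]] eq by auto
    then show ?thesis using semiregular_unique eq xy(1) by blast
  qed
qed

lemma semiregular_orbits:
  defines "\<O> \<equiv> orbit (G\<lparr>carrier := C\<rparr>) \<phi> ` \<Omega>"
  shows "disjoint \<O>" "W \<in> \<O> \<Longrightarrow> W \<subseteq> \<Omega> \<and> card W = card C" "card C * card \<O> = card \<Omega>"
proof -
  show disj: "disjoint \<O>"
    using C.disjoint_union \<Omega>_subset unfolding disjoint_def \<O>_def orbits_def by blast
  have orbit: "orbit (G\<lparr>carrier := C\<rparr>) \<phi> x = (\<lambda>g. \<phi> g x) ` C" for x by (auto simp: orbit_def)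
  have W: "W \<subseteq> \<Omega> \<and> card W = card C" if W: "W \<in> \<O>" for W
  proof -
    obtain x where x: "x \<in> \<Omega>" "W = (\<lambda>g. \<phi> g x) ` C" using W by (auto simp: \<O>_def orbit)
    have "inj_on (\<lambda>g. \<phi> g x) C" using semiregular_unique x(1) by (intro inj_onI)
    then show ?thesis using x \<Omega>_invariant by (auto simp: card_image)
  qed
  then show "W \<in> \<O> \<Longrightarrow> W \<subseteq> \<Omega> \<and> card W = card C" .
  have union: "\<Union>\<O> = \<Omega>" using W C.orbit_refl \<Omega>_subset unfolding \<O>_def by blast
  have "card C * card \<O> = card (\<Union>\<O>)"
    by (rule card_partition) (use finite_\<Omega> disj W union in \<open>auto simp: \<O>_def disjoint_def\<close>)
  then show "card C * card \<O> = card \<Omega>" by (simp only: union)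
qed

end

section \<open>Two-transitive actions\<close>

lemma (in group) card_vimage_transitive:
  fixes \<phi> :: "'a \<Rightarrow> 'y \<Rightarrow> 'y"
  assumes fin: "finite (carrier G)" "finite Y" and P: "P \<subseteq> Y" and y: "y \<in> Y"
    and closed: "\<And>g. g \<in> carrier G \<Longrightarrow> \<phi> g y \<in> Y"
    and mult: "\<And>g h. g \<in> carrier G \<Longrightarrow> h \<in> carrier G \<Longrightarrow> \<phi> (g \<otimes> h) y = \<phi> g (\<phi> h y)"
    and transitive: "\<And>u v. u \<in> Y \<Longrightarrow> v \<in> Y \<Longrightarrow> \<exists>g\<in>carrier G. \<phi> g u = v"
  shows "card {g\<in>carrier G. \<phi> g y \<in> P} * card Y = card P * card (carrier G)"
proof -
  define F where "F = (\<lambda>z. {g\<in>carrier G. \<phi> g y = z})"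
  have F_le: "card (F u) \<le> card (F v)" if uv: "u \<in> Y" "v \<in> Y" for u v
  proof -
    obtain a where a: "a \<in> carrier G" "\<phi> a u = v" using transitive[OF uv] by blast
    show ?thesis
    proof (rule card_inj_on_le)
      show "inj_on (\<lambda>g. a \<otimes> g) (F u)" using a(1) by (auto simp: inj_on_def F_def)
      show "(\<lambda>g. a \<otimes> g) ` F u \<subseteq> F v" using a mult by (auto simp: F_def)
    qed (use fin(1) in \<open>simp add: F_def\<close>)
  qed
  have F_const: "card (F z) = card (F y)" if "z \<in> Y" for z using F_le that y by (simp add: le_antisym)
  have count: "card {g\<in>carrier G. \<phi> g y \<in> Q} = card Q * card (F y)" if "Q \<subseteq> Y" for Q
  proof -
    have "{g\<in>carrier G. \<phi> g y \<in> Q} = (\<Union>z\<in>Q. F z)" by (auto simp: F_def)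
    also have "card \<dots> = (\<Sum>z\<in>Q. card (F z))"
      using that fin finite_subset[OF that] by (intro card_UN_disjoint) (auto simp: F_def)
    finally show ?thesis using that F_const by (simp add: subset_iff)
  qed
  have "{g\<in>carrier G. \<phi> g y \<in> Y} = carrier G" using closed by auto
  then show ?thesis using count[OF P] count[of Y] by simp
qed

definition distinct_pairs :: "'a set \<Rightarrow> ('a \<times> 'a) set" where
  "distinct_pairs S = {(x, y)\<in>S \<times> S. x \<noteq> y}"

lemma finite_distinct_pairs: "finite S \<Longrightarrow> finite (distinct_pairs S)"
  unfolding distinct_pairs_def by (auto intro: finite_subset[of _ "S \<times> S"])

lemma card_distinct_pairs:
  assumes "finite S"
  shows "card (distinct_pairs S) = card S * (card S - 1)"
proof -
  have "distinct_pairs S = S \<times> S - (\<lambda>x. (x, x)) ` S" by (auto simp: distinct_pairs_def)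
  moreover have "card ((\<lambda>x. (x, x)) ` S) = card S" by (rule card_image) (auto intro: inj_onI)
  ultimately show ?thesis
    using assms by (simp add: card_Diff_subset image_subset_iff card_cartesian_product diff_mult_distrib2)
qed

locale two_transitive_action = group_action G E \<phi> for G (structure) and E :: "'w set" and \<phi> +
  fixes \<Omega> :: "'w set"
  assumes finite_carrier: "finite (carrier G)" and finite_\<Omega>: "finite \<Omega>" and \<Omega>_subset: "\<Omega> \<subseteq> E"
    and \<Omega>_invariant: "\<And>g x. g \<in> carrier G \<Longrightarrow> x \<in> \<Omega> \<Longrightarrow> \<phi> g x \<in> \<Omega>"
    and transitive: "\<And>x y. x \<in> \<Omega> \<Longrightarrow> y \<in> \<Omega> \<Longrightarrow> \<exists>g\<in>carrier G. \<phi> g x = y"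
    and two_transitive: "\<And>x y x' y'. x \<in> \<Omega> \<Longrightarrow> y \<in> \<Omega> \<Longrightarrow> x \<noteq> y \<Longrightarrow>
        x' \<in> \<Omega> \<Longrightarrow> y' \<in> \<Omega> \<Longrightarrow> x' \<noteq> y' \<Longrightarrow> \<exists>g\<in>carrier G. \<phi> g x = x' \<and> \<phi> g y = y'"
begin

interpretation group G by (rule is_group)

lemma act_eq_iff_eq: "g \<in> carrier G \<Longrightarrow> x \<in> \<Omega> \<Longrightarrow> y \<in> \<Omega> \<Longrightarrow> \<phi> g x = \<phi> g y \<longleftrightarrow> x = y"
  using inj_prop \<Omega>_subset by (auto dest: inj_onD)

lemma card_hits:
  assumes "x \<in> \<Omega>" "T \<subseteq> \<Omega>"
  shows "card {g\<in>carrier G. \<phi> g x \<in> T} * card \<Omega> = card T * card (carrier G)"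
  using assms finite_carrier finite_\<Omega> \<Omega>_subset \<Omega>_invariant transitive
  by (intro card_vimage_transitive) (auto simp: composition_rule)

lemma card_hits_pair:
  assumes "z \<in> distinct_pairs \<Omega>" "T \<subseteq> \<Omega>"
  shows "card {g\<in>carrier G. map_prod (\<phi> g) (\<phi> g) z \<in> distinct_pairs T} * card (distinct_pairs \<Omega>)
    = card (distinct_pairs T) * card (carrier G)"
proof (rule card_vimage_transitive)
  show "\<exists>g\<in>carrier G. map_prod (\<phi> g) (\<phi> g) u = v"
    if "u \<in> distinct_pairs \<Omega>" "v \<in> distinct_pairs \<Omega>" for u v
    using that two_transitive[of "fst u" "snd u" "fst v" "snd v"] by (force simp: distinct_pairs_def)
  show "finite (distinct_pairs \<Omega>)" using finite_\<Omega> by (rule finite_distinct_pairs)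
qed (use assms finite_carrier \<Omega>_invariant act_eq_iff_eq in
  \<open>auto simp: distinct_pairs_def composition_rule subsetD[OF \<Omega>_subset]\<close>)

definition hits :: "'w set \<Rightarrow> 'w set \<Rightarrow> 'a \<Rightarrow> nat" where
  "hits S T g = card {x\<in>S. \<phi> g x \<in> T}"

lemma sum_hits:
  assumes "S \<subseteq> \<Omega>" "T \<subseteq> \<Omega>"
  shows "(\<Sum>g\<in>carrier G. hits S T g) * card \<Omega> = card S * card T * card (carrier G)"
proof -
  have "finite S" using assms(1) finite_\<Omega> by (rule finite_subset)
  then have "(\<Sum>g\<in>carrier G. hits S T g) = (\<Sum>x\<in>S. card {g\<in>carrier G. \<phi> g x \<in> T})"
    unfolding hits_def using finite_carrier by (intro sum_multicount_gen) auto
  then show ?thesis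
    using assms card_hits by (simp add: sum_distrib_right subset_iff)
qed

lemma sum_hits_pairs:
  assumes "S \<subseteq> \<Omega>" "T \<subseteq> \<Omega>"
  shows "(\<Sum>g\<in>carrier G. hits S T g * (hits S T g - 1)) * (card \<Omega> * (card \<Omega> - 1))
    = card S * (card S - 1) * (card T * (card T - 1)) * card (carrier G)"
proof -
  have fin: "finite S" "finite T" using assms finite_\<Omega> by (auto intro: finite_subset)
  have "hits S T g * (hits S T g - 1)
      = card {z\<in>distinct_pairs S. map_prod (\<phi> g) (\<phi> g) z \<in> distinct_pairs T}"
    if "g \<in> carrier G" for g
  proof -
    have "distinct_pairs {x\<in>S. \<phi> g x \<in> T}
        = {z\<in>distinct_pairs S. map_prod (\<phi> g) (\<phi> g) z \<in> distinct_pairs T}"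
      using act_eq_iff_eq[OF that] by (auto simp: distinct_pairs_def subsetD[OF assms(1)])
    then show ?thesis using card_distinct_pairs[of "{x\<in>S. \<phi> g x \<in> T}"] fin(1) by (simp add: hits_def)
  qed
  then have "(\<Sum>g\<in>carrier G. hits S T g * (hits S T g - 1))
      = (\<Sum>z\<in>distinct_pairs S. card {g\<in>carrier G. map_prod (\<phi> g) (\<phi> g) z \<in> distinct_pairs T})"
    using finite_carrier fin(1) by (simp add: sum_multicount_gen finite_distinct_pairs)
  moreover have "(\<Sum>z\<in>distinct_pairs S. card {g\<in>carrier G. map_prod (\<phi> g) (\<phi> g) z \<in> distinct_pairs T})
      * card (distinct_pairs \<Omega>) = (\<Sum>z\<in>distinct_pairs S. card (distinct_pairs T) * card (carrier G))"
    unfolding sum_distrib_right using assms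
    by (intro sum.cong refl card_hits_pair) (auto simp: distinct_pairs_def)
  ultimately show ?thesis by (simp add: card_distinct_pairs fin finite_\<Omega> mult_ac)
qed

lemma sum_hits_deviation:
  fixes S T :: "'w set"
  defines "M \<equiv> real (card (carrier G))" and "n \<equiv> real (card \<Omega>)" and "s \<equiv> real (card S)" and "t \<equiv> real (card T)"
  assumes "S \<subseteq> \<Omega>" "T \<subseteq> \<Omega>"
  shows "(n - 1) * (\<Sum>g\<in>carrier G. (n * hits S T g - s * t)\<^sup>2) = s * t * ((n - s) * (n - t)) * M"
proof -
  have pred: "real m * real (m - 1) = real m * (real m - 1)" for m :: nat by (cases m) auto
  define \<mu>\<^sub>1 where "\<mu>\<^sub>1 = (\<Sum>g\<in>carrier G. real (hits S T g))"
  define \<mu>\<^sub>2 where "\<mu>\<^sub>2 = (\<Sum>g\<in>carrier G. real (hits S T g) * (real (hits S T g) - 1))"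
  have first_moment: "\<mu>\<^sub>1 * n = s * t * M"
    using arg_cong[OF sum_hits[OF assms(5,6)], of real] by (simp add: \<mu>\<^sub>1_def M_def n_def s_def t_def)
  have second_moment: "\<mu>\<^sub>2 * (n * (n - 1)) = s * (s - 1) * (t * (t - 1)) * M"
    using arg_cong[OF sum_hits_pairs[OF assms(5,6)], of real]
    by (simp add: \<mu>\<^sub>2_def M_def n_def s_def t_def pred del: One_nat_def)
  have "(\<Sum>g\<in>carrier G. (n * hits S T g - s * t)\<^sup>2) = n\<^sup>2 * (\<mu>\<^sub>2 + \<mu>\<^sub>1) - 2 * n * s * t * \<mu>\<^sub>1 + s\<^sup>2 * t\<^sup>2 * M"
  proof -
    have "(n * hits S T g - s * t)\<^sup>2 = n\<^sup>2 * (real (hits S T g) * (real (hits S T g) - 1))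
        + (n\<^sup>2 - 2 * n * s * t) * hits S T g + s\<^sup>2 * t\<^sup>2" for g
      by (simp add: power2_eq_square algebra_simps)
    then show ?thesis
      by (simp add: sum.distrib flip: sum_distrib_left \<mu>\<^sub>1_def \<mu>\<^sub>2_def) (simp add: M_def algebra_simps)
  qed
  also have "(n - 1) * \<dots> = n * (\<mu>\<^sub>2 * (n * (n - 1))) + (n - 1) * (n * (\<mu>\<^sub>1 * n) - 2 * s * t * (\<mu>\<^sub>1 * n) + s\<^sup>2 * t\<^sup>2 * M)"
    by (simp add: power2_eq_square algebra_simps)
  also have "\<dots> = s * t * ((n - s) * (n - t)) * M"
    unfolding first_moment second_moment by (simp add: power2_eq_square algebra_simps)
  finally show ?thesis .
qed

text \<open>Chebyshev's inequality for the number of hits of a random group element.\<close>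

lemma card_avoiding_le:
  assumes "S \<subseteq> \<Omega>" "T \<subseteq> \<Omega>"
  shows "card {g\<in>carrier G. \<forall>x\<in>S. \<phi> g x \<notin> T} * (card S * card T * (card \<Omega> - 1))
    \<le> (card \<Omega> - card S) * (card \<Omega> - card T) * card (carrier G)"
proof (cases "card S * card T = 0")
  case False
  define n s t where "n = real (card \<Omega>)" and "s = real (card S)" and "t = real (card T)"
  have st: "s * t > 0" using False by (simp add: s_def t_def)
  have card_le: "card S \<le> card \<Omega>" "card T \<le> card \<Omega>" using assms finite_\<Omega> by (auto intro: card_mono)
  then have n1: "n - 1 \<ge> 0" using False by (cases "card \<Omega>") (auto simp: n_def)
  let ?avoiding = "{g\<in>carrier G. \<forall>x\<in>S. \<phi> g x \<notin> T}"
  have "hits S T g = 0" if "g \<in> ?avoiding" for g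
  proof -
    have "{x\<in>S. \<phi> g x \<in> T} = {}" using that by blast
    then show ?thesis by (simp only: hits_def card.empty)
  qed
  then have "card ?avoiding * (s * t)\<^sup>2 = (\<Sum>g\<in>?avoiding. (n * hits S T g - s * t)\<^sup>2)" by simp
  also have "\<dots> \<le> (\<Sum>g\<in>carrier G. (n * hits S T g - s * t)\<^sup>2)"
    using finite_carrier by (intro sum_mono2) auto
  finally have "(n - 1) * (card ?avoiding * (s * t)\<^sup>2) \<le> (n - 1) * \<dots>" using n1 by (rule mult_left_mono)
  also have "\<dots> = s * t * ((n - s) * (n - t)) * card (carrier G)"
    unfolding n_def s_def t_def using assms by (rule sum_hits_deviation)
  finally have "(s * t) * (card ?avoiding * (s * t * (n - 1))) \<le> (s * t) * ((n - s) * (n - t) * card (carrier G))"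
    by (simp add: power2_eq_square mult_ac)
  then have "card ?avoiding * (s * t * (n - 1)) \<le> (n - s) * (n - t) * card (carrier G)"
    using st by (simp only: mult_le_cancel_left_pos)
  moreover have "real (card \<Omega> - 1) = n - 1" using n1 by (simp add: n_def)
  moreover have "real (card \<Omega> - card S) = n - s" "real (card \<Omega> - card T) = n - t"
    using card_le by (simp_all add: n_def s_def t_def)
  ultimately have "real (card ?avoiding * (card S * card T * (card \<Omega> - 1)))
      \<le> real ((card \<Omega> - card S) * (card \<Omega> - card T) * card (carrier G))"
    by (simp only: of_nat_mult s_def t_def)
  then show ?thesis by (simp only: of_nat_le_iff)
qed auto

lemma exists_connecting_element:
  assumes "finite I" and S: "\<And>i. i \<in> I \<Longrightarrow> S i \<subseteq> \<Omega> \<and> card (S i) = r"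
    and T: "\<And>i. i \<in> I \<Longrightarrow> T i \<subseteq> \<Omega> \<and> card (T i) = r"
    and less: "card I * (card \<Omega> - r)\<^sup>2 < r\<^sup>2 * (card \<Omega> - 1)"
  obtains a where "a \<in> carrier G" "\<And>i. i \<in> I \<Longrightarrow> \<exists>x\<in>S i. \<phi> a x \<in> T i"
proof -
  define avoiding where "avoiding = (\<lambda>i. {g\<in>carrier G. \<forall>x\<in>S i. \<phi> g x \<notin> T i})"
  have "card (\<Union>i\<in>I. avoiding i) * (r\<^sup>2 * (card \<Omega> - 1)) \<le> (\<Sum>i\<in>I. card (avoiding i)) * (r\<^sup>2 * (card \<Omega> - 1))"
    using assms(1) by (intro mult_right_mono card_UN_le) auto
  also have "\<dots> = (\<Sum>i\<in>I. card (avoiding i) * (r\<^sup>2 * (card \<Omega> - 1)))" by (rule sum_distrib_right)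
  also have "\<dots> \<le> (\<Sum>i\<in>I. (card \<Omega> - r)\<^sup>2 * card (carrier G))"
  proof (rule sum_mono)
    fix i assume i: "i \<in> I"
    show "card (avoiding i) * (r\<^sup>2 * (card \<Omega> - 1)) \<le> (card \<Omega> - r)\<^sup>2 * card (carrier G)"
      using card_avoiding_le[of "S i" "T i"] S[OF i] T[OF i] by (simp add: avoiding_def power2_eq_square)
  qed
  also have "\<dots> = card I * (card \<Omega> - r)\<^sup>2 * card (carrier G)" by simp
  also have "\<dots> < r\<^sup>2 * (card \<Omega> - 1) * card (carrier G)"
    using less finite_carrier by (simp add: card_gt_0_iff carrier_not_empty)
  finally have "card (\<Union>i\<in>I. avoiding i) < card (carrier G)" by (simp add: mult.commute)
  moreover have "(\<Union>i\<in>I. avoiding i) \<subseteq> carrier G" by (auto simp: avoiding_def)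
  ultimately obtain a where "a \<in> carrier G" "a \<notin> (\<Union>i\<in>I. avoiding i)" by (metis less_irrefl subsetI subset_antisym)
  then show ?thesis using that by (auto simp: avoiding_def)
qed

end

lemma (in group_action) tiling_one_and:
  assumes a: "a \<in> carrier G" and Y: "Y \<subseteq> E" and disj: "Y \<inter> \<phi> a ` Y = {}"
  shows "tiling \<phi> {\<one>, a} Y (Y \<union> \<phi> a ` Y)"
proof (rule tilingI)
  show "g = h \<and> x = y" if eq: "g \<in> {\<one>, a}" "h \<in> {\<one>, a}" "x \<in> Y" "y \<in> Y" "\<phi> g x = \<phi> h y" for g h x y
  proof -
    have "\<phi> a x = \<phi> a y \<longleftrightarrow> x = y" using inj_on_eq_iff[OF inj_prop[OF a]] Y eq(3,4) by blast
    moreover have "x \<noteq> \<phi> a y" "\<phi> a x \<noteq> y" using disj eq(3,4) by blast+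
    ultimately show ?thesis using eq by (auto simp: one_acts subsetD[OF Y])
  qed
qed (auto simp: one_acts subsetD[OF Y])

lemma ex1_in_choice_image:
  assumes "disjoint \<B>" "\<And>W. W \<in> \<B> \<Longrightarrow> w W \<in> W" "W \<in> \<B>"
  shows "\<exists>!x. x \<in> w ` \<B> \<inter> W"
proof (rule ex1I[of _ "w W"])
  fix x assume "x \<in> w ` \<B> \<inter> W"
  then obtain V where "V \<in> \<B>" "x = w V" "x \<in> W" by blast
  then show "x = w W" using assms(2) disjointD[OF assms(1,3), of V] by blast
qed (use assms in blast)

lemma inj_on_choice:
  assumes "disjoint \<B>" "\<And>W. W \<in> \<B> \<Longrightarrow> w W \<in> W"
  shows "inj_on w \<B>"
proof (rule inj_onI)
  fix V W assume "V \<in> \<B>" "W \<in> \<B>" "w V = w W"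
  then show "V = W" using assms(2)[of V] assms(2)[of W] disjointD[OF assms(1), of V W] by auto
qed

lemma pairing_if_card_even:
  assumes "card \<B> = 2 * p" "p > 0"
  obtains \<S> f where "\<S> \<subseteq> \<B>" "finite \<S>" "card \<S> = p" "bij_betw f \<S> (\<B> - \<S>)"
proof -
  have "finite \<B>" using assms by (metis card.infinite mult_is_0 less_numeral_extra(3) zero_neq_numeral)
  obtain \<S> where \<S>: "\<S> \<subseteq> \<B>" "card \<S> = p" "finite \<S>"
    using obtain_subset_with_card_n[of p \<B>] assms by auto
  then have "card (\<B> - \<S>) = card \<S>" using assms by (simp add: card_Diff_subset)
  then obtain f where "bij_betw f \<S> (\<B> - \<S>)"
    using \<S>(3) \<open>finite \<B>\<close> finite_same_card_bij by (metis finite_Diff)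
  then show ?thesis using that \<S> by blast
qed

lemma extend_choice_along_pairing:
  assumes f: "bij_betw f \<S> (\<B> - \<S>)" and y: "\<And>W. W \<in> \<S> \<Longrightarrow> y W \<in> W \<and> h (y W) \<in> f W"
  obtains w where "\<And>W. W \<in> \<B> \<Longrightarrow> w W \<in> W" "w ` (\<B> - \<S>) = h ` w ` \<S>"
proof -
  define w where "w = (\<lambda>W. if W \<in> \<S> then y W else h (y (inv_into \<S> f W)))"
  have range_f: "\<B> - \<S> = f ` \<S>" using f by (simp add: bij_betw_def)
  have w_f: "w (f W) = h (w W)" if "W \<in> \<S>" for W
  proof -
    have "f W \<notin> \<S>" using that bij_betwE[OF f] by blast
    then show ?thesis using that bij_betw_imp_inj_on[OF f] by (simp add: w_def)
  qed
  have "w W \<in> W" if "W \<in> \<B>" for W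
  proof (cases "W \<in> \<S>")
    case False
    then have "W \<in> f ` \<S>" using that by (simp flip: range_f)
    then obtain V where "V \<in> \<S>" "W = f V" by blast
    then show ?thesis using y[of V] w_f[of V] by (simp add: w_def)
  qed (simp add: w_def y)
  moreover have "w ` (\<B> - \<S>) = h ` w ` \<S>" unfolding range_f image_image using w_f by simp
  ultimately show ?thesis using that by metis
qed

lemma (in two_transitive_action) paired_blocks_transversal:
  assumes block: "\<And>W. W \<in> \<B> \<Longrightarrow> W \<subseteq> \<Omega> \<and> card W = r" and disj: "disjoint \<B>"
    and card: "card \<B> = 2 * p" "p > 0" and less: "p * (card \<Omega> - r)\<^sup>2 < r\<^sup>2 * (card \<Omega> - 1)"
  obtains a Y R where "a \<in> carrier G" "a \<noteq> \<one>" "Y \<subseteq> \<Omega>" "card Y = p" "R \<subseteq> \<Omega>"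
    "tiling \<phi> {\<one>, a} Y R" "\<And>W. W \<in> \<B> \<Longrightarrow> \<exists>!x. x \<in> R \<inter> W"
proof -
  obtain \<S> f where \<S>: "\<S> \<subseteq> \<B>" "finite \<S>" "card \<S> = p" and f: "bij_betw f \<S> (\<B> - \<S>)"
    using pairing_if_card_even[OF card] .
  have f_in: "f W \<in> \<B>" if "W \<in> \<S>" for W using bij_betwE[OF f] that by blast
  obtain a where a: "a \<in> carrier G" "\<And>W. W \<in> \<S> \<Longrightarrow> \<exists>x\<in>W. \<phi> a x \<in> f W"
  proof (rule exists_connecting_element[of \<S> "\<lambda>W. W" r f])
    show "card \<S> * (card \<Omega> - r)\<^sup>2 < r\<^sup>2 * (card \<Omega> - 1)" using less \<S>(3) by simp
  qed (use \<S> f_in block in blast)+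
  then obtain y where y: "\<And>W. W \<in> \<S> \<Longrightarrow> y W \<in> W \<and> \<phi> a (y W) \<in> f W" by metis
  obtain w where w: "\<And>W. W \<in> \<B> \<Longrightarrow> w W \<in> W" and image: "w ` (\<B> - \<S>) = \<phi> a ` w ` \<S>"
    by (rule extend_choice_along_pairing[where y = y and h = "\<phi> a", OF f y]) blast+
  have inj: "inj_on w \<B>" using disj w by (rule inj_on_choice)
  have "w ` \<S> \<inter> w ` (\<B> - \<S>) = {}" using inj_on_image_Int[OF inj \<S>(1), of "\<B> - \<S>"] by blast
  then have disj_w: "w ` \<S> \<inter> \<phi> a ` w ` \<S> = {}" by (simp only: image)
  have \<B>: "w ` \<B> = w ` \<S> \<union> \<phi> a ` w ` \<S>" using \<S>(1) by (auto simp flip: image)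
  have w_subset: "w ` \<B> \<subseteq> \<Omega>" using w block by blast
  then have w_\<S>: "w ` \<S> \<subseteq> \<Omega>" "w ` \<S> \<subseteq> E" using \<S>(1) \<Omega>_subset by blast+
  have card_w: "card (w ` \<S>) = p" using card_image[OF inj_on_subset[OF inj \<S>(1)]] \<S>(3) by simp
  have "a \<noteq> \<one>"
  proof
    assume "a = \<one>"
    then have "\<phi> a ` w ` \<S> = w ` \<S>" using w_\<S>(2) by (force simp: one_acts)
    then show False using disj_w card_w card(2) by auto
  qed
  moreover have "tiling \<phi> {\<one>, a} (w ` \<S>) (w ` \<B>)"
    unfolding \<B> using a(1) w_\<S>(2) disj_w by (rule tiling_one_and)
  moreover have "\<exists>!x. x \<in> w ` \<B> \<inter> W" if "W \<in> \<B>" for W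
    using disj w that by (rule ex1_in_choice_image)
  ultimately show ?thesis using that a(1) w_\<S>(1) card_w w_subset by blast
qed

section \<open>Roots of unity and quadratic extensions of finite fields\<close>

definition additive_group :: "'a::ab_group_add monoid" where
  "additive_group = \<lparr>carrier = UNIV, mult = (+), one = 0\<rparr>"

definition unit_group :: "'a::field monoid" where
  "unit_group = \<lparr>carrier = UNIV - {0}, mult = (*), one = 1\<rparr>"

lemma additive_group_simps [simp]:
  "carrier additive_group = UNIV" "mult additive_group = (+)" "one additive_group = 0"
  by (simp_all add: additive_group_def)

lemma unit_group_simps [simp]:
  "carrier unit_group = UNIV - {0}" "mult unit_group = (*)" "one unit_group = 1"
  by (simp_all add: unit_group_def)

lemma comm_group_additive_group: "comm_group additive_group"
  by (rule comm_groupI) (auto simp: algebra_simps intro: exI[of _ "- x" for x])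

lemma comm_group_unit_group: "comm_group unit_group"
proof (rule comm_groupI)
  fix x :: 'a assume "x \<in> carrier unit_group"
  then show "\<exists>y\<in>carrier unit_group. y \<otimes>\<^bsub>unit_group\<^esub> x = \<one>\<^bsub>unit_group\<^esub>"
    by (intro bexI[of _ "inverse x"]) auto
qed auto

lemma finite_field_power_card:
  fixes x :: "'a::{field, finite}"
  shows "x \<noteq> 0 \<Longrightarrow> x ^ (CARD('a) - 1) = 1" "x ^ CARD('a) = x"
proof -
  interpret comm_group "unit_group :: 'a monoid" by (rule comm_group_unit_group)
  have pow: "x [^]\<^bsub>unit_group\<^esub> n = x ^ n" for n :: nat by (induction n) (simp_all add: mult.commute)
  show unit: "x ^ (CARD('a) - 1) = 1" if "x \<noteq> 0"
    using pow_order_eq_1[of x] that by (simp add: pow Coset.order_def card_Diff_subset)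
  have "CARD('a) = Suc (CARD('a) - 1)" by simp
  then have "x ^ CARD('a) = x * x ^ (CARD('a) - 1)" by (metis power_Suc)
  then show "x ^ CARD('a) = x" using unit by (cases "x = 0") simp_all
qed

lemma card_le_if_roots:
  fixes p :: "'b::field poly"
  assumes "coeff p n \<noteq> 0" "degree p \<le> n" "\<And>x. x \<in> A \<Longrightarrow> poly p x = 0"
  shows "card A \<le> n"
proof -
  have "p \<noteq> 0" using assms(1) by auto
  then have "card A \<le> card {x. poly p x = 0}"
    using assms(3) poly_roots_finite by (intro card_mono) auto
  also have "\<dots> \<le> degree p" using \<open>p \<noteq> 0\<close> by (rule card_poly_roots_bound)
  finally show ?thesis using assms(2) by simp
qed

lemma card_fibres_eq:
  assumes fin: "finite A" "finite B" and f: "f ` A \<subseteq> B"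
    and card: "card A = n * m" "card B \<le> m" "n > 0"
    and fibre_le: "\<And>y. y \<in> B \<Longrightarrow> card {x\<in>A. f x = y} \<le> n"
  shows "card B = m" "y \<in> B \<Longrightarrow> card {x\<in>A. f x = y} = n"
proof -
  have sum: "card A = (\<Sum>y\<in>B. card {x\<in>A. f x = y})"
    using sum.group[OF fin f, of "\<lambda>_. 1 :: nat"] by simp
  also have "\<dots> \<le> n * card B"
    using sum_bounded_above[of B "\<lambda>y. card {x\<in>A. f x = y}" n] fibre_le by (simp add: mult.commute)
  finally show card_B: "card B = m" using card by simp
  assume y: "y \<in> B"
  show "card {x\<in>A. f x = y} = n"
  proof (rule ccontr)
    assume "card {x\<in>A. f x = y} \<noteq> n"
    then have "(\<Sum>y\<in>B. card {x\<in>A. f x = y}) < (\<Sum>y\<in>B. n)"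
      using fibre_le y fin(2) le_neq_implies_less[OF fibre_le[OF y]] by (intro sum_strict_mono_ex1) auto
    then show False using sum card(1) card_B by (simp add: mult.commute)
  qed
qed

definition primitive_root :: "nat \<Rightarrow> 'a::monoid_mult \<Rightarrow> bool" where
  "primitive_root n z \<longleftrightarrow> (\<forall>t. z ^ t = 1 \<longleftrightarrow> n dvd t)"

lemma power_gcd_eq_1:
  fixes z :: "'a::monoid_mult"
  assumes "z ^ m = 1" "z ^ n = 1" "m > 0"
  shows "z ^ gcd m n = 1"
proof -
  obtain x y where "m * x = n * y + gcd m n" using bezout_nat[of m n] assms(3) by auto
  then have "z ^ (m * x) = z ^ (n * y) * z ^ gcd m n" by (simp add: power_add)
  then show ?thesis using assms by (simp add: power_mult)
qed

lemma primitive_root_mult: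
  fixes w z :: "'a::comm_monoid_mult"
  assumes "primitive_root m w" "primitive_root n z" "coprime m n"
  shows "primitive_root (m * n) (w * z)"
  unfolding primitive_root_def
proof (intro allI iffI)
  fix t assume t: "(w * z) ^ t = 1"
  have "w ^ (t * n) * z ^ (t * n) = 1" "w ^ (t * m) * z ^ (t * m) = 1"
    using t by (simp_all add: power_mult flip: power_mult_distrib)
  moreover have "z ^ (t * n) = 1" "w ^ (t * m) = 1" using assms(1,2) by (simp_all add: primitive_root_def)
  ultimately have "m dvd t * n" "n dvd t * m" using assms(1,2) by (simp_all add: primitive_root_def)
  then have "m dvd t" "n dvd t" using assms(3) by (simp_all add: coprime_dvd_mult_left_iff coprime_commute)
  then show "m * n dvd t" using assms(3) by (simp add: divides_mult)
next
  fix t assume "m * n dvd t"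
  then have "m dvd t" "n dvd t" using dvd_mult_left dvd_mult_right by blast+
  then have "w ^ t = 1" "z ^ t = 1" using assms(1,2) by (simp_all add: primitive_root_def)
  then show "(w * z) ^ t = 1" by (simp add: power_mult_distrib)
qed

lemma primitive_root_if_power:
  assumes "primitive_root m (y ^ s)" "s dvd m"
  shows "primitive_root (s * m) y"
  unfolding primitive_root_def
proof (intro allI iffI)
  fix t assume t: "y ^ t = 1"
  then have "(y ^ s) ^ t = 1" by (metis power_mult power_one mult.commute)
  then have "s dvd t" using assms dvd_trans by (auto simp: primitive_root_def)
  then obtain u where u: "t = s * u" by auto
  then have "(y ^ s) ^ u = 1" using t by (simp add: power_mult)
  then show "s * m dvd t" using assms(1) u by (simp add: primitive_root_def)
next
  fix t assume "s * m dvd t"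
  then obtain u where "t = s * (m * u)" by (metis dvdE mult.assoc)
  then have "y ^ t = (y ^ s) ^ (m * u)" by (simp only: power_mult)
  then show "y ^ t = 1" using assms(1) by (simp add: primitive_root_def)
qed

lemma primitive_root_prime_exists:
  assumes "prime s" "of_nat s \<noteq> (0 :: 'b::alg_closed_field)"
  shows "\<exists>z :: 'b. primitive_root s z"
proof -
  have "s - 1 > 0" using prime_gt_1_nat[OF assms(1)] by simp
  then obtain z :: 'b where "(\<Sum>k\<le>s - 1. 1 * z ^ k) = 0"
    using alg_closed[of "s - 1" "\<lambda>_. 1 :: 'b"] by auto
  moreover have "{..s - 1} = {..<s}" using prime_gt_0_nat[OF assms(1)] by auto
  ultimately have z: "(\<Sum>k<s. z ^ k) = 0" by simp
  then have zs: "z ^ s = 1" using power_diff_1_eq[of z s] by simp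
  have "z \<noteq> 1" using z assms(2) by auto
  have "s dvd t" if "z ^ t = 1" for t
  proof (rule ccontr)
    assume "\<not> s dvd t"
    then have "gcd s t = 1" using assms(1) by (simp add: prime_imp_coprime)
    then show False using power_gcd_eq_1[OF zs that] \<open>z \<noteq> 1\<close> prime_gt_0_nat[OF assms(1)] by simp
  qed
  then have "primitive_root s z" using zs by (auto simp: primitive_root_def power_mult)
  then show ?thesis by blast
qed

lemma primitive_root_exists:
  assumes "of_nat n \<noteq> (0 :: 'b::alg_closed_field)"
  shows "\<exists>z :: 'b. primitive_root n z"
  using assms
proof (induction n rule: prime_divisors_induct[case_names zero unit factor])
  case (unit n)
  then show ?case by (intro exI[of _ 1]) (auto simp: primitive_root_def)
next
  case (factor s m)
  then obtain z :: 'b where z: "primitive_root m z" by auto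
  show ?case
  proof (cases "s dvd m")
    case True
    obtain y where "y ^ s = z" using nth_root_exists[OF prime_gt_0_nat[OF factor(1)]] by blast
    then show ?thesis using primitive_root_if_power True z by blast
  next
    case False
    then have "coprime s m" using factor(1) by (simp add: prime_imp_coprime)
    moreover obtain w :: 'b where "primitive_root s w"
      using primitive_root_prime_exists factor(1,3) by auto
    ultimately show ?thesis using primitive_root_mult z by blast
  qed
qed simp

locale unitary_field =
  fixes q :: nat and F :: "'a::{field, finite} itself"
  assumes card_field: "CARD('a) = q ^ 2"
    and prime_power: "\<exists>p k. prime p \<and> k \<ge> 1 \<and> q = p ^ k"
    and odd_q: "odd q"
begin

definition cj :: "'a \<Rightarrow> 'a" where "cj x = x ^ q"

lemma q_gt_2: "q > 2"
proof -
  obtain p k where "prime p" "k \<ge> 1" "q = p ^ k" using prime_power by blast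
  then have "q > 1" using one_less_power[of p k] prime_gt_1_nat[of p] by simp
  then show ?thesis using odd_q by (cases "q = 2") auto
qed

lemma prime_CHAR: "prime CHAR('a)"
  using finite_imp_CHAR_pos[where ?'a = 'a] prime_CHAR_semidom by auto

lemma q_eq_CHAR_power: "\<exists>k. q = CHAR('a) ^ k"
proof -
  obtain p k where p: "prime p" "k \<ge> 1" "q = p ^ k" using prime_power by blast
  have "CHAR('a) dvd p ^ (k * 2)"
    using CHAR_dvd_CARD[where ?'a = 'a] unfolding card_field p(3) power_mult .
  then have "CHAR('a) = p" using prime_CHAR p(1) prime_dvd_power primes_dvd_imp_eq by blast
  then show ?thesis using p by blast
qed

lemma cj_add [simp]: "cj (x + y) = cj x + cj y"
  unfolding cj_def using q_eq_CHAR_power prime_CHAR freshmans_dream' by blast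

lemma cj_mult [simp]: "cj (x * y) = cj x * cj y"
  by (simp add: cj_def power_mult_distrib)

lemma cj_cj [simp]: "cj (cj x) = x"
  using finite_field_power_card(2)[of x] by (simp add: cj_def card_field power2_eq_square flip: power_mult)

lemma cj_0 [simp]: "cj 0 = 0" and cj_1 [simp]: "cj 1 = 1"
  using q_gt_2 by (simp_all add: cj_def)

lemma cj_minus [simp]: "cj (- x) = - cj x"
  by (simp add: cj_def odd_q)

lemma cj_diff [simp]: "cj (x - y) = cj x - cj y"
  using cj_add[of x "- y"] by simp

lemma cj_inverse [simp]: "cj (inverse x) = inverse (cj x)"
  by (simp add: cj_def power_inverse)

lemma cj_divide [simp]: "cj (x / y) = cj x / cj y"
  by (simp add: cj_def power_divide)

lemma cj_numeral [simp]: "cj (numeral n) = numeral n"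
proof -
  have "cj (of_nat m) = of_nat m" for m by (induction m) auto
  from this[of "numeral n"] show ?thesis by simp
qed

lemma cj_eq_iff [simp]: "cj x = cj y \<longleftrightarrow> x = y"
  by (metis cj_cj)

lemma cj_eq_0_iff [simp]: "cj x = 0 \<longleftrightarrow> x = 0"
  using cj_eq_iff[of x 0] by simp

lemma two_neq_0 [simp]: "(2 :: 'a) \<noteq> 0"
proof
  assume "(2 :: 'a) = 0"
  then have "CHAR('a) dvd 2" using of_nat_eq_0_iff_char_dvd[of 2] by (metis of_nat_numeral)
  then have "CHAR('a) = 2" using prime_CHAR by (metis primes_dvd_imp_eq two_is_prime_nat)
  then obtain k where "q = 2 ^ k" using q_eq_CHAR_power by auto
  then show False using odd_q q_gt_2 by (cases k) auto
qed

lemma power_of_two_neq_0 [simp]: "(4 :: 'a) \<noteq> 0" "(8 :: 'a) \<noteq> 0" "(16 :: 'a) \<noteq> 0" "(64 :: 'a) \<noteq> 0"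
  using power_not_zero[OF two_neq_0, of 2] power_not_zero[OF two_neq_0, of 3]
    power_not_zero[OF two_neq_0, of 4] power_not_zero[OF two_neq_0, of 6] by simp_all

lemma neg_eq_self_iff: "- x = x \<longleftrightarrow> x = (0 :: 'a)"
proof
  assume "- x = x"
  then have "2 * x = 0" by (metis mult_2 add.right_inverse)
  then show "x = 0" by simp
qed simp

lemma card_fixed_le: "card {x. cj x = x} \<le> q"
  by (rule card_le_if_roots[of "monom 1 q - monom 1 1"])
     (use q_gt_2 in \<open>auto simp: poly_monom cj_def degree_monom_eq intro!: degree_diff_le\<close>)

lemma card_trace_fibre_le: "card {x. x + cj x = t} \<le> q"
  by (rule card_le_if_roots[of "monom 1 q + (monom 1 1 - [:t:])"])
     (use q_gt_2 in \<open>auto simp: poly_monom cj_def degree_monom_eq coeff_pCons split: nat.splits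
        intro!: degree_diff_le degree_add_le\<close>)

lemma card_norm_fibre_le: "card {x. x * cj x = t} \<le> q + 1"
  by (rule card_le_if_roots[of "monom 1 (q + 1) - [:t:]"])
     (use q_gt_2 in \<open>auto simp: poly_monom cj_def degree_monom_eq coeff_pCons split: nat.splits
        intro!: degree_diff_le\<close>)

lemma card_fixed: "card {x. cj x = x} = q"
  and card_trace_fibre: "cj t = t \<Longrightarrow> card {x. x + cj x = t} = q"
proof -
  have "(\<lambda>x. x + cj x) ` UNIV \<subseteq> {x. cj x = x}" by (auto simp: add.commute)
  moreover have "CARD('a) = q * q" by (simp add: card_field power2_eq_square)
  moreover have "q > 0" using q_gt_2 by simp
  moreover have "card {x \<in> UNIV. x + cj x = y} \<le> q" for y using card_trace_fibre_le[of y] by simp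
  ultimately have "card {x. cj x = x} = q"
    "cj t = t \<Longrightarrow> card {x \<in> UNIV. x + cj x = t} = q"
    using card_fibres_eq[of "UNIV :: 'a set" "{x. cj x = x}" "\<lambda>x. x + cj x" q q] card_fixed_le by simp_all
  then show "card {x. cj x = x} = q" "cj t = t \<Longrightarrow> card {x. x + cj x = t} = q" by simp_all
qed

lemma trace_surj: "cj t = t \<Longrightarrow> \<exists>x. x + cj x = t"
  using card_trace_fibre[of t] q_gt_2 by (metis (mono_tags, lifting) Collect_empty_eq card.empty not_less_zero)

lemma norm_surj:
  assumes "cj t = t"
  shows "\<exists>x. x * cj x = t"
proof (cases "t = 0")
  case False
  have "card {x \<in> UNIV - {0}. x * cj x = t} = q + 1"
  proof (rule card_fibres_eq(2)[of "UNIV - {0}" "{x. cj x = x} - {0}" _ "q + 1" "q - 1"])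
    show "(\<lambda>x. x * cj x) ` (UNIV - {0}) \<subseteq> {x. cj x = x} - {0}" by (auto simp: mult.commute)
    have "(q + 1) * (q - 1) = q ^ 2 - 1"
      using q_gt_2 by (simp add: algebra_simps power2_eq_square)
    then show "card (UNIV - {0 :: 'a}) = (q + 1) * (q - 1)" by (simp add: card_field)
    show "card ({x. cj x = x} - {0}) \<le> q - 1" using card_fixed by simp
    show "card {x \<in> UNIV - {0}. x * cj x = y} \<le> q + 1" for y
      by (rule order_trans[OF card_mono card_norm_fibre_le[of y]]) auto
  qed (use assms False in auto)
  then show ?thesis by (metis (mono_tags, lifting) Collect_empty_eq card.empty add_is_0 zero_neq_one)
qed (intro exI[of _ 0], simp)

end

section \<open>Special isometry groups\<close>

definition special_isometry_group :: "('a::field^'n \<Rightarrow> 'a^'n \<Rightarrow> 'a) \<Rightarrow> ('a^'n^'n) monoid" where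
  "special_isometry_group B =
     \<lparr>carrier = {A. det A = 1 \<and> (\<forall>x y. B (A *v x) (A *v y) = B x y)}, mult = (**), one = mat 1\<rparr>"

lemma special_isometry_group_simps [simp]:
  "mult (special_isometry_group B) = (**)" "one (special_isometry_group B) = mat 1"
  by (simp_all add: special_isometry_group_def)

lemma mem_special_isometry_group_iff:
  "A \<in> carrier (special_isometry_group B) \<longleftrightarrow> det A = 1 \<and> (\<forall>x y. B (A *v x) (A *v y) = B x y)"
  by (simp add: special_isometry_group_def)

lemma group_special_isometry_group: "group (special_isometry_group B)"
proof (rule groupI)
  fix A assume A: "A \<in> carrier (special_isometry_group B)"
  then have "invertible A" by (simp add: invertible_det_nz mem_special_isometry_group_iff)
  then obtain A' where A': "A ** A' = mat 1" "A' ** A = mat 1" unfolding invertible_def by blast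
  have "det A' = 1" using A arg_cong[OF A'(2), of det] by (simp add: det_mul mem_special_isometry_group_iff)
  moreover have "B (A' *v x) (A' *v y) = B x y" for x y
  proof -
    have "B (A' *v x) (A' *v y) = B (A *v (A' *v x)) (A *v (A' *v y))"
      using A by (simp add: mem_special_isometry_group_iff)
    then show ?thesis by (simp add: matrix_vector_mul_assoc A')
  qed
  ultimately show "\<exists>A'\<in>carrier (special_isometry_group B).
      A' \<otimes>\<^bsub>special_isometry_group B\<^esub> A = \<one>\<^bsub>special_isometry_group B\<^esub>"
    using A' by (auto simp: mem_special_isometry_group_iff)
qed (auto simp: mem_special_isometry_group_iff det_mul matrix_mul_assoc simp flip: matrix_vector_mul_assoc)

lemma special_isometry_group_iso:
  fixes P P' :: "'a::field^'n^'n"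
  assumes P: "P ** P' = mat 1" "P' ** P = mat 1" and form: "\<And>x y. B (P *v x) (P *v y) = B' x y"
  shows "(\<lambda>A. P' ** A ** P) \<in> iso (special_isometry_group B) (special_isometry_group B')"
proof -
  have form': "B' (P' *v x) (P' *v y) = B x y" for x y
    using form[of "P' *v x" "P' *v y"] by (simp add: matrix_vector_mul_assoc P)
  have det: "det P * det P' = 1" using P(1) by (metis det_I det_mul)
  have conj: "P' ** A ** P \<in> carrier (special_isometry_group B')"
    if "A \<in> carrier (special_isometry_group B)" for A
    using that det
    by (simp add: mem_special_isometry_group_iff det_mul form form' mult.commute flip: matrix_vector_mul_assoc)
  have conj': "P ** A ** P' \<in> carrier (special_isometry_group B)"
    if "A \<in> carrier (special_isometry_group B')" for A
    using that det
    by (simp add: mem_special_isometry_group_iff det_mul form form' mult.commute flip: matrix_vector_mul_assoc)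
  have cancel: "P ** (P' ** A) = A" "P' ** (P ** A) = A" for A by (simp_all add: matrix_mul_assoc P)
  have "bij_betw (\<lambda>A. P' ** A ** P) (carrier (special_isometry_group B)) (carrier (special_isometry_group B'))"
    by (rule bij_betwI[where g = "\<lambda>A. P ** A ** P'"])
       (use conj conj' in \<open>auto simp: cancel P simp flip: matrix_mul_assoc\<close>)
  moreover have "(P' ** A ** P) ** (P' ** C ** P) = P' ** (A ** C) ** P" for A C
    by (simp add: cancel flip: matrix_mul_assoc)
  ultimately show ?thesis using conj by (auto simp: iso_def hom_def)
qed

definition matrix_image :: "'a::field^'n^'n \<Rightarrow> ('a^'n) set \<Rightarrow> ('a^'n) set" where
  "matrix_image A V = (*v) A ` V"

lemma matrix_image_mat_1 [simp]: "matrix_image (mat 1) V = V"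
  by (simp add: matrix_image_def)

lemma matrix_image_mult: "matrix_image (A ** B) V = matrix_image A (matrix_image B V)"
  by (simp add: matrix_image_def image_image matrix_vector_mul_assoc)

lemma group_action_matrix_image:
  "group_action (special_isometry_group B) UNIV (matrix_image :: 'a::field^'n^'n \<Rightarrow> _)"
proof -
  interpret group "special_isometry_group B" by (rule group_special_isometry_group)
  have "bij (matrix_image A)" if "A \<in> carrier (special_isometry_group B)" for A
    using l_inv[OF that] r_inv[OF that]
    by (intro o_bij[of "matrix_image (inv\<^bsub>special_isometry_group B\<^esub> A)"])
       (simp_all add: fun_eq_iff flip: matrix_image_mult)
  then have "matrix_image \<in> hom (special_isometry_group B) (BijGroup UNIV)"
    by (auto simp: hom_def BijGroup_def Bij_def compose_def fun_eq_iff matrix_image_mult)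
  then show ?thesis
    using group_BijGroup[of UNIV] is_group by (simp add: group_action_def group_hom_def group_hom_axioms_def)
qed

abbreviation point :: "'a::field^'n \<Rightarrow> ('a^'n) set" where
  "point x \<equiv> vec.span {x}"

lemma matrix_image_point [simp]: "matrix_image A (point x) = point (A *v x)"
  using vec.span_image[of A "{x}"] by (simp add: matrix_image_def)

lemma point_eq_iff: "point x = point y \<longleftrightarrow> (\<exists>c. c \<noteq> 0 \<and> y = c *s x)"
proof
  assume eq: "point x = point y"
  then obtain c where c: "y = c *s x" using vec.span_base[of y "{y}"] by (auto simp: vec.span_singleton)
  show "\<exists>c. c \<noteq> 0 \<and> y = c *s x"
  proof (cases "y = 0")
    case True
    then have "x = 0" using eq vec.span_base[of x "{x}"] by simp
    then show ?thesis using True by (intro exI[of _ 1]) simp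
  next
    case False
    then show ?thesis using c by auto
  qed
next
  assume "\<exists>c. c \<noteq> 0 \<and> y = c *s x"
  then obtain c where c: "c \<noteq> 0" "y = c *s x" by blast
  then have "x = inverse c *s y" by simp
  then have "x \<in> point y" "y \<in> point x" using c(2) by (auto simp: vec.span_singleton)
  then show "point x = point y" by (intro equalityI vec.span_minimal) auto
qed

lemma point_scale: "c \<noteq> 0 \<Longrightarrow> point (c *s x) = point x"
  using point_eq_iff by metis

section \<open>The special unitary group of a hyperbolic form\<close>

abbreviation vec3 :: "'a \<Rightarrow> 'a \<Rightarrow> 'a \<Rightarrow> 'a::zero^3" where
  "vec3 a b c \<equiv> vector [a, b, c]"

abbreviation mat3 :: "'a \<Rightarrow> 'a \<Rightarrow> 'a \<Rightarrow> 'a \<Rightarrow> 'a \<Rightarrow> 'a \<Rightarrow> 'a \<Rightarrow> 'a \<Rightarrow> 'a \<Rightarrow> 'a::zero^3^3" where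
  "mat3 a b c d e f g h i \<equiv> vector [vec3 a b c, vec3 d e f, vec3 g h i]"

lemma vec3_eq_iff: "(x :: 'a^3) = y \<longleftrightarrow> x $ 1 = y $ 1 \<and> x $ 2 = y $ 2 \<and> x $ 3 = y $ 3"
  by (simp add: vec_eq_iff forall_3)

lemma matrix_vector_mult_3:
  "((A :: 'a::semiring_1^3^3) *v x) $ i = A $ i $ 1 * x $ 1 + A $ i $ 2 * x $ 2 + A $ i $ 3 * x $ 3"
  by (simp add: matrix_vector_mult_def sum_3)

lemma matrix_matrix_mult_3:
  "((A :: 'a::semiring_1^3^3) ** B) $ i $ j = A $ i $ 1 * B $ 1 $ j + A $ i $ 2 * B $ 2 $ j + A $ i $ 3 * B $ 3 $ j"
  by (simp add: matrix_matrix_mult_def sum_3)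

lemma point_eq_affine: "x $ 3 \<noteq> 0 \<Longrightarrow> point x = point (vec3 (x $ 1 / x $ 3) (x $ 2 / x $ 3) 1)"
  for x :: "'a::field^3"
  unfolding point_eq_iff by (intro exI[of _ "inverse (x $ 3)"]) (simp add: vec3_eq_iff field_simps)

lemma point_eq_at_infinity: "x $ 3 = 0 \<Longrightarrow> x $ 2 \<noteq> 0 \<Longrightarrow> point x = point (vec3 (x $ 1 / x $ 2) 1 0)"
  for x :: "'a::field^3"
  unfolding point_eq_iff by (intro exI[of _ "inverse (x $ 2)"]) (simp add: vec3_eq_iff field_simps)

lemma point_vec3_eq_iff:
  "point (vec3 a b 1) = point (vec3 a' b' 1) \<longleftrightarrow> a = a' \<and> b = b'"
  "point (vec3 a 1 0) = point (vec3 a' 1 0) \<longleftrightarrow> a = a'"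
  "point (vec3 a 1 0) \<noteq> point (vec3 a' b 1)"
  "point (vec3 1 0 0) \<noteq> point (vec3 a b 1)"
  for a b a' b' :: "'a::field"
  by (auto simp: point_eq_iff vec3_eq_iff)

context unitary_field
begin

definition hform :: "'a^3 \<Rightarrow> 'a^3 \<Rightarrow> 'a" where
  "hform x y = x $ 1 * cj (y $ 3) + x $ 2 * cj (y $ 2) + x $ 3 * cj (y $ 1)"

abbreviation SU :: "('a^3^3) monoid" where
  "SU \<equiv> special_isometry_group hform"

sublocale SU: group SU
  by (rule group_special_isometry_group)

sublocale points: group_action SU UNIV matrix_image
  by (rule group_action_matrix_image)

abbreviation point_stabilizer :: "'a^3 \<Rightarrow> ('a^3^3) set" where
  "point_stabilizer x \<equiv> stabilizer SU matrix_image (point x)"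

abbreviation "e1 \<equiv> vec3 1 0 0 :: 'a^3"
abbreviation "e2 \<equiv> vec3 0 1 0 :: 'a^3"
abbreviation "e3 \<equiv> vec3 0 0 1 :: 'a^3"

lemma mem_point_stabilizer_iff: "A \<in> point_stabilizer x \<longleftrightarrow> A \<in> carrier SU \<and> point (A *v x) = point x"
  by (simp add: stabilizer_def)

lemma hform_SU: "A \<in> carrier SU \<Longrightarrow> hform (A *v x) (A *v y) = hform x y"
  and det_SU: "A \<in> carrier SU \<Longrightarrow> det A = 1"
  by (simp_all add: mem_special_isometry_group_iff)

lemma hform_scale: "hform (c *s x) (d *s y) = c * cj d * hform x y"
  by (simp add: hform_def algebra_simps)

lemma cj_hform: "cj (hform x y) = hform y x"
  by (simp add: hform_def algebra_simps)

lemma SU_mult_eq_0_iff [simp]: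
  assumes "A \<in> carrier SU"
  shows "A *v x = 0 \<longleftrightarrow> x = 0"
  using SU.l_inv[OF assms] matrix_vector_mul_assoc[of "inv\<^bsub>SU\<^esub> A" A x] by auto

lemma SU_I:
  assumes "det A = 1"
    and "hform (column 1 A) (column 1 A) = 0" "hform (column 1 A) (column 2 A) = 0"
      "hform (column 1 A) (column 3 A) = 1" "hform (column 2 A) (column 2 A) = 1"
      "hform (column 2 A) (column 3 A) = 0" "hform (column 3 A) (column 3 A) = 0"
  shows "A \<in> carrier SU"
proof -
  have "hform (A *v x) (A *v y) = (\<Sum>i\<in>UNIV. \<Sum>j\<in>UNIV. x $ i * cj (y $ j) * hform (column i A) (column j A))"
    for x y
    by (simp add: hform_def matrix_vector_mult_3 column_def sum_3 algebra_simps)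
  moreover have "hform (column 2 A) (column 1 A) = 0" "hform (column 3 A) (column 1 A) = 1"
      "hform (column 3 A) (column 2 A) = 0"
    using assms(3,4,6) cj_hform cj_0 cj_1 by metis+
  ultimately have "hform (A *v x) (A *v y) = hform x y" for x y
    using assms(2-) by (simp add: sum_3 hform_def[of x y])
  then show ?thesis using assms(1) by (simp add: mem_special_isometry_group_iff)
qed

definition unip :: "'a \<Rightarrow> 'a \<Rightarrow> 'a^3^3" where
  "unip \<alpha> \<beta> = mat3 1 (- cj \<alpha>) \<beta> 0 1 \<alpha> 0 0 1"

lemma unip_in_SU:
  assumes "\<beta> + cj \<beta> + \<alpha> * cj \<alpha> = 0"
  shows "unip \<alpha> \<beta> \<in> carrier SU"
  using assms by (intro SU_I) (auto simp: unip_def det_3 hform_def column_def algebra_simps)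

definition weyl :: "'a^3^3" where
  "weyl = mat3 0 0 1 0 (- 1) 0 1 0 0"

lemma weyl_in_SU: "weyl \<in> carrier SU"
  by (intro SU_I) (auto simp: weyl_def det_3 hform_def column_def)

section \<open>The Borel subgroup\<close>

abbreviation borel :: "('a^3^3) set" where
  "borel \<equiv> point_stabilizer e1"

lemma borel_entries:
  assumes "A \<in> borel"
  shows "A $ 1 $ 1 \<noteq> 0" "A $ 2 $ 1 = 0" "A $ 3 $ 1 = 0"
proof -
  obtain c where c: "c \<noteq> 0" "e1 = c *s (A *v e1)"
    using assms unfolding mem_point_stabilizer_iff point_eq_iff by auto
  then have "1 = c * A $ 1 $ 1" "0 = c * A $ 2 $ 1" "0 = c * A $ 3 $ 1"
    unfolding vec3_eq_iff by (auto simp: matrix_vector_mult_3)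
  then show "A $ 1 $ 1 \<noteq> 0" "A $ 2 $ 1 = 0" "A $ 3 $ 1 = 0" using c(1) by auto
qed

lemma unipotent_entries:
  assumes "A \<in> borel" "A $ 1 $ 1 = 1"
  shows "A $ 2 $ 2 = 1" "A $ 3 $ 2 = 0" "A $ 3 $ 3 = 1" "A $ 1 $ 2 = - cj (A $ 2 $ 3)"
proof -
  note [simp] = borel_entries[OF assms(1)] assms(2)
  have A: "A \<in> carrier SU" using assms(1) by (simp add: mem_point_stabilizer_iff)
  show [simp]: "A $ 3 $ 2 = 0"
    using hform_SU[OF A, of e1 e2] by (simp add: hform_def matrix_vector_mult_3)
  show [simp]: "A $ 3 $ 3 = 1"
    using hform_SU[OF A, of e1 e3] cj_eq_iff[of "A $ 3 $ 3" 1] by (simp add: hform_def matrix_vector_mult_3)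
  show [simp]: "A $ 2 $ 2 = 1"
    using det_SU[OF A] by (simp add: det_3)
  show "A $ 1 $ 2 = - cj (A $ 2 $ 3)"
    using hform_SU[OF A, of e2 e3] by (simp add: hform_def matrix_vector_mult_3 eq_neg_iff_add_eq_0)
qed

lemma unipotent_image:
  assumes "A \<in> borel" "A $ 1 $ 1 = 1"
  shows "A *v e2 = vec3 (- cj (A $ 2 $ 3)) 1 0" "A *v vec3 x 0 1 = vec3 (x + A $ 1 $ 3) (A $ 2 $ 3) 1"
  using borel_entries[OF assms(1)] unipotent_entries[OF assms] assms(2)
  by (simp_all add: vec3_eq_iff matrix_vector_mult_3)

lemma unip_in_borel:
  assumes "\<beta> + cj \<beta> + \<alpha> * cj \<alpha> = 0"
  shows "unip \<alpha> \<beta> \<in> borel"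
proof -
  have "unip \<alpha> \<beta> *v e1 = e1" by (simp add: unip_def vec3_eq_iff matrix_vector_mult_3)
  then show ?thesis using unip_in_SU[OF assms] by (simp add: mem_point_stabilizer_iff)
qed

lemma borel_entry_hom:
  assumes "K \<subseteq> borel"
  shows "(\<lambda>A. A $ 1 $ 1) \<in> hom (SU\<lparr>carrier := K\<rparr>) unit_group"
    and "(\<And>A. A \<in> K \<Longrightarrow> A $ 1 $ 1 = 1) \<Longrightarrow> (\<lambda>A. A $ 2 $ 3) \<in> hom (SU\<lparr>carrier := K\<rparr>) additive_group"
    and "(\<And>A. A \<in> K \<Longrightarrow> A $ 1 $ 1 = 1 \<and> A $ 2 $ 3 = 0) \<Longrightarrow>
      (\<lambda>A. A $ 1 $ 3) \<in> hom (SU\<lparr>carrier := K\<rparr>) additive_group"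
  using assms borel_entries unipotent_entries
  by (auto simp: hom_def matrix_matrix_mult_3 add.commute subset_iff)

lemma borel_eq_mat_1:
  assumes "A \<in> borel" "A $ 1 $ 1 = 1" "A $ 2 $ 3 = 0" "A $ 1 $ 3 = 0"
  shows "A = mat 1"
  using borel_entries[OF assms(1)] unipotent_entries[OF assms(1,2)] assms(2-)
  by (simp add: vec_eq_iff forall_3 mat_def)

lemma solvable_borel_subgroup:
  assumes K: "subgroup K SU" "K \<subseteq> borel"
  shows "solvable (SU\<lparr>carrier := K\<rparr>)"
proof -
  define L where "L = {A\<in>K. A $ 1 $ 1 = \<one>\<^bsub>unit_group\<^esub>}"
  define M where "M = {A\<in>L. A $ 2 $ 3 = \<one>\<^bsub>additive_group\<^esub>}"
  define N where "N = {A\<in>M. A $ 1 $ 3 = \<one>\<^bsub>additive_group\<^esub>}"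
  have sub: "L \<subseteq> borel" "M \<subseteq> borel" using K(2) by (auto simp: L_def M_def)
  have homs: "(\<lambda>A. A $ 1 $ 1) \<in> hom (SU\<lparr>carrier := K\<rparr>) unit_group"
    "(\<lambda>A. A $ 2 $ 3) \<in> hom (SU\<lparr>carrier := L\<rparr>) additive_group"
    "(\<lambda>A. A $ 1 $ 3) \<in> hom (SU\<lparr>carrier := M\<rparr>) additive_group"
    by (auto intro!: borel_entry_hom K(2) sub) (auto simp: L_def M_def)
  note groups = comm_group.axioms(2)[OF comm_group_unit_group] comm_group.axioms(2)[OF comm_group_additive_group]
  have L: "subgroup L SU"
    unfolding L_def using K(1) groups(1) homs(1) by (rule SU.subgroup_kernel_restrict)
  then have M: "subgroup M SU"
    unfolding M_def using groups(2) homs(2) by (rule SU.subgroup_kernel_restrict)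
  then have N: "subgroup N SU"
    unfolding N_def using groups(2) homs(3) by (rule SU.subgroup_kernel_restrict)
  have "A = mat 1" if "A \<in> N" for A
    using that K(2) by (intro borel_eq_mat_1) (auto simp: N_def M_def L_def)
  moreover have "mat 1 \<in> N" using subgroup.one_closed[OF N] by simp
  ultimately have "N = {mat 1}" by blast
  then have "solvable (SU\<lparr>carrier := N\<rparr>)"
    using solvable_seq.unity[of "SU\<lparr>carrier := N\<rparr>"] by (simp add: solvable_def)
  then have "solvable (SU\<lparr>carrier := M\<rparr>)"
    unfolding N_def by (rule SU.solvable_if_solvable_kernel_restrict[OF M comm_group_additive_group homs(3)])
  then have "solvable (SU\<lparr>carrier := L\<rparr>)"
    unfolding M_def by (rule SU.solvable_if_solvable_kernel_restrict[OF L comm_group_additive_group homs(2)])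
  then show ?thesis
    unfolding L_def by (rule SU.solvable_if_solvable_kernel_restrict[OF K(1) comm_group_unit_group homs(1)])
qed

lemma min_factorisable_borel_subgroup:
  assumes "subgroup K SU" "K \<subseteq> borel"
  shows "min_factorisable SU K"
  using assms solvable_borel_subgroup by (intro SU.min_factorisable_if_solvable_subgroup) auto

section \<open>A factorisation through the stabiliser of a non-isotropic point\<close>

definition norm_one :: "'a set" where
  "norm_one = {a. a * cj a = 1}"

text \<open>In an orthogonal basis of the plane spanned by \<open>e1\<close> and \<open>e3\<close>, extended by \<open>e2\<close>, this is the
  diagonal matrix with entries \<open>a\<close>, \<open>1\<close> and \<open>1 / a\<close>.\<close>

definition rot :: "'a \<Rightarrow> 'a^3^3" where
  "rot a = mat3 ((a + 1) / 2) 0 ((a - 1) / 4) 0 (inverse a) 0 (a - 1) 0 ((a + 1) / 2)"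

lemma norm_one_neq_0: "a \<in> norm_one \<Longrightarrow> a \<noteq> 0"
  by (auto simp: norm_one_def)

lemma subgroup_norm_one: "subgroup norm_one unit_group"
proof -
  have "(\<lambda>a. a * cj a) \<in> hom unit_group unit_group" by (auto simp: hom_def)
  then have "group_hom unit_group unit_group (\<lambda>a. a * cj a)"
    using comm_group_unit_group[where ?'a = 'a] by (simp add: group_hom_def group_hom_axioms_def comm_group_def)
  then have "subgroup (kernel unit_group unit_group (\<lambda>a. a * cj a)) unit_group"
    by (rule group_hom.subgroup_kernel)
  moreover have "kernel unit_group unit_group (\<lambda>a. a * cj a) = norm_one"
    by (auto simp: kernel_def norm_one_def)
  ultimately show ?thesis by simp
qed

lemma rot_in_SU:
  assumes "a \<in> norm_one"
  shows "rot a \<in> carrier SU"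
proof -
  have "a \<noteq> 0" "cj a = inverse a" using assms by (auto simp: norm_one_def inverse_unique)
  then show ?thesis
    by (intro SU_I) (simp_all add: rot_def det_3 hform_def column_def field_simps)
qed

lemma rot_in_stabilizer:
  assumes "a \<in> norm_one"
  shows "rot a \<in> point_stabilizer e2"
proof -
  have "rot a *v e2 = inverse a *s e2" by (simp add: rot_def vec3_eq_iff matrix_vector_mult_3)
  then show ?thesis
    using rot_in_SU[OF assms] norm_one_neq_0[OF assms] by (simp add: mem_point_stabilizer_iff point_scale)
qed

lemma rot_mult: "a \<noteq> 0 \<Longrightarrow> b \<noteq> 0 \<Longrightarrow> rot a ** rot b = rot (a * b)"
  unfolding vec_eq_iff forall_3 by (simp add: rot_def matrix_matrix_mult_3 field_simps)

lemma rot_e1: "rot a *v e1 = vec3 ((a + 1) / 2) 0 (a - 1)"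
  by (simp add: rot_def vec3_eq_iff matrix_vector_mult_3)

lemma min_factorisable_rot: "min_factorisable (SU\<lparr>carrier := point_stabilizer e2\<rparr>) (rot ` norm_one)"
proof -
  let ?N = "unit_group\<lparr>carrier := norm_one\<rparr>" and ?H = "SU\<lparr>carrier := point_stabilizer e2\<rparr>"
  interpret units: comm_group "unit_group :: 'a monoid" by (rule comm_group_unit_group)
  have N: "comm_group ?N"
    using units.subgroup_imp_group[OF subgroup_norm_one]
    by (rule group.group_comm_groupI) (simp add: mult.commute)
  have H: "group ?H"
    by (intro SU.subgroup_imp_group points.stabilizer_subgroup) simp
  have "rot \<in> hom ?N ?H"
    using rot_in_stabilizer rot_mult norm_one_neq_0 by (auto simp: hom_def)
  then interpret rot: group_hom ?N ?H rot
    using N H by (simp add: group_hom_def group_hom_axioms_def comm_group_def)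
  have "solvable_seq ?N norm_one" using comm_group.solvable_comm_group[OF N] by (simp add: solvable_def)
  then have "solvable_seq ?H (rot ` norm_one)" by (rule rot.solvable_imp_solvable_img)
  then show ?thesis by (rule rot.H.min_factorisable_if_solvable_seq) simp
qed

text \<open>The parameter of the rotation is the Cayley transform of \<open>2 x / z\<close>.\<close>

lemma rot_transitive:
  assumes "x \<noteq> 0 \<or> z \<noteq> 0" "x * cj z + z * cj x = 0"
  shows "\<exists>a\<in>norm_one. point (rot a *v e1) = point (vec3 x 0 z)"
proof (cases "z = 0")
  case True
  then have "point (rot 1 *v e1) = point (vec3 x 0 z)"
    using assms(1) unfolding point_eq_iff by (auto simp: rot_e1 vec3_eq_iff)
  then show ?thesis by (intro bexI[of _ 1]) (simp_all add: norm_one_def)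
next
  case False
  define t where "t = 2 * (x / z)"
  have cj_t: "cj t = - t"
  proof -
    have "cj x / cj z = - (x / z)" using False assms(2) by (simp add: field_simps eq_neg_iff_add_eq_0)
    then show ?thesis by (simp only: t_def cj_mult cj_divide cj_numeral mult_minus_right)
  qed
  have "t \<noteq> c" if "cj c = c" "c \<noteq> 0" for c
    using that cj_t neg_eq_self_iff by metis
  then have nz: "t - 1 \<noteq> 0" "t + 1 \<noteq> 0" by (auto simp: eq_neg_iff_add_eq_0[symmetric])
  define a where "a = (t + 1) / (t - 1)"
  have "cj a = (- (t - 1)) / (- (t + 1))" by (simp add: a_def cj_t)
  also have "\<dots> = (t - 1) / (t + 1)" by (rule minus_divide_divide)
  finally have "a \<in> norm_one" using nz by (simp add: norm_one_def a_def)
  moreover have "point (rot a *v e1) = point (vec3 x 0 z)"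
  proof -
    have "a + 1 = 2 * t / (t - 1)" "a - 1 = 2 / (t - 1)" using nz by (simp_all add: a_def field_simps)
    then show ?thesis unfolding rot_e1 point_eq_iff using nz False
      by (intro exI[of _ "z * (t - 1) / 2"]) (auto simp: vec3_eq_iff t_def)
  qed
  ultimately show ?thesis by blast
qed

lemma inj_on_rot_e1: "inj_on (\<lambda>a. point (rot a *v e1)) norm_one"
proof (rule inj_onI)
  fix a b assume "point (rot a *v e1) = point (rot b *v e1)"
  then obtain c where c: "(b + 1) / 2 = c * ((a + 1) / 2)" "b - 1 = c * (a - 1)"
    unfolding rot_e1 point_eq_iff by (auto simp: vec3_eq_iff)
  have "b + 1 = 2 * ((b + 1) / 2)" by simp
  also have "\<dots> = c * (a + 1)" unfolding c(1) by simp
  finally have "(b + 1) * (a - 1) = (b - 1) * (a + 1)" using c(2) by simp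
  then have "2 * (a - b) = 0" by (simp add: algebra_simps)
  then show "a = b" by simp
qed

lemma orbit_e1_stabilizer_e2:
  "orbit (SU\<lparr>carrier := point_stabilizer e2\<rparr>) matrix_image (point e1) = (\<lambda>a. point (rot a *v e1)) ` norm_one"
  (is "?orbit = ?rot")
proof
  show "?orbit \<subseteq> ?rot"
  proof
    fix P assume "P \<in> ?orbit"
    then obtain A where A: "A \<in> carrier SU" "point (A *v e2) = point e2" and P: "P = point (A *v e1)"
      by (auto simp: orbit_def mem_point_stabilizer_iff)
    define y where "y = A *v e1"
    obtain c where c: "c \<noteq> 0" "A *v e2 = c *s e2" using A(2) point_eq_iff by metis
    have "hform y (A *v e2) = 0" "hform y y = 0" using hform_SU[OF A(1)] by (simp_all add: y_def hform_def)
    then have y2: "y $ 2 = 0" and y13: "y $ 1 * cj (y $ 3) + y $ 3 * cj (y $ 1) = 0"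
      using c by (auto simp: hform_def)
    have "e1 \<noteq> 0" by (simp add: vec3_eq_iff)
    then have "y \<noteq> 0" using A(1) by (simp add: y_def)
    then have "y $ 1 \<noteq> 0 \<or> y $ 3 \<noteq> 0" using y2 by (simp add: vec3_eq_iff)
    from rot_transitive[OF this y13]
    obtain a where "a \<in> norm_one" "point (rot a *v e1) = point (vec3 (y $ 1) 0 (y $ 3))" by blast
    moreover have "vec3 (y $ 1) 0 (y $ 3) = y" using y2 by (simp add: vec3_eq_iff)
    ultimately show "P \<in> ?rot" by (auto simp: P y_def)
  qed
  show "?rot \<subseteq> ?orbit" using rot_in_stabilizer by (force simp: orbit_def)
qed

lemma min_factorisable_stabilizer_e2: "min_factorisable SU (point_stabilizer e2)"
proof -
  define H where "H = SU\<lparr>carrier := point_stabilizer e2\<rparr>"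
  have sub: "subgroup (point_stabilizer e2) SU" by (rule points.stabilizer_subgroup) simp
  interpret H: group_action H UNIV matrix_image
    unfolding H_def using sub by (rule points.induced_action)
  have "bij_betw (\<lambda>A. matrix_image A (point e1)) (rot ` norm_one) (orbit H matrix_image (point e1))"
    unfolding H_def orbit_e1_stabilizer_e2
    using inj_on_rot_e1 by (auto simp: bij_betw_def image_image comp_def intro: inj_on_imageI)
  then have tiles: "min_tiles H matrix_image {point e1} (orbit H matrix_image (point e1))"
    using min_factorisable_rot unfolding min_tiles_def tiling_singleton_iff H_def by blast
  have "min_factorisable H (carrier H)"
  proof (rule H.min_factorisable_if_min_tiles_orbit[OF _ _ tiles])
    define K where "K = stabilizer H matrix_image (point e1)"
    have "subgroup K H" unfolding K_def by (rule H.stabilizer_subgroup) simp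
    then have K: "subgroup K SU" using SU.incl_subgroup[OF sub] by (simp add: H_def)
    have "K \<subseteq> borel" by (auto simp: K_def H_def stabilizer_def)
    then have "solvable (SU\<lparr>carrier := K\<rparr>)" using K by (intro solvable_borel_subgroup)
    then have "solvable (H\<lparr>carrier := K\<rparr>)" by (simp add: H_def)
    then show "min_factorisable H K"
      using \<open>subgroup K H\<close> by (intro group.min_factorisable_if_solvable_subgroup[OF H.is_group]) simp_all
  qed simp_all
  then have "min_factorisable (SU\<lparr>carrier := point_stabilizer e2\<rparr>) (point_stabilizer e2)" by (simp add: H_def)
  then show ?thesis using subgroup.subset[OF sub] by (rule min_factorisable_carrier_mono)
qed

lemma unipotent_transversal:
  obtains U where "U \<subseteq> {A\<in>borel. A $ 1 $ 1 = 1}" "min_factorisable SU U" "bij_betw (\<lambda>A. A $ 2 $ 3) U UNIV"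
proof -
  define Q where "Q = {A\<in>borel. A $ 1 $ 1 = \<one>\<^bsub>unit_group\<^esub>}"
  have "subgroup borel SU" by (rule points.stabilizer_subgroup) simp
  then have Q: "subgroup Q SU"
    unfolding Q_def using comm_group_unit_group borel_entry_hom(1)
    by (intro SU.subgroup_kernel_restrict) (auto simp: comm_group_def)
  have hom: "(\<lambda>A. A $ 2 $ 3) \<in> hom (SU\<lparr>carrier := Q\<rparr>) additive_group"
    by (rule borel_entry_hom(2)) (auto simp: Q_def)
  have "\<alpha> \<in> (\<lambda>A. A $ 2 $ 3) ` Q" for \<alpha>
  proof -
    obtain \<beta> where "\<beta> + cj \<beta> = - (\<alpha> * cj \<alpha>)"
      using trace_surj[of "- (\<alpha> * cj \<alpha>)"] by (auto simp: mult.commute)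
    then have "unip \<alpha> \<beta> \<in> Q" using unip_in_borel[of \<beta> \<alpha>] by (simp add: Q_def unip_def)
    then show ?thesis by (rule rev_image_eqI) (simp add: unip_def)
  qed
  then have surj: "(\<lambda>A. A $ 2 $ 3) ` carrier (SU\<lparr>carrier := Q\<rparr>) = carrier additive_group" by auto
  have "min_factorisable additive_group (carrier (additive_group :: 'a monoid))"
    by (intro comm_group.min_factorisable_comm_group comm_group_additive_group) simp
  from group.min_factorisable_lift[OF SU.subgroup_imp_group[OF Q] _ hom surj this] comm_group_additive_group
  obtain U where U: "min_factorisable (SU\<lparr>carrier := Q\<rparr>) U" "bij_betw (\<lambda>A. A $ 2 $ 3) U UNIV"
    by (auto simp: comm_group_def)
  have "U \<subseteq> Q" using group.min_factorisable_subset[OF SU.subgroup_imp_group[OF Q] U(1)] by simp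
  moreover have "min_factorisable SU U"
    using U(1) subgroup.subset[OF Q] by (rule min_factorisable_carrier_mono)
  ultimately show ?thesis using that U(2) by (simp add: Q_def)
qed

definition nonisotropic :: "('a^3) set set" where
  "nonisotropic = {point x | x. hform x x \<noteq> 0}"

lemma nonisotropic_at_infinity: "point (vec3 a 1 0) \<in> nonisotropic"
  unfolding nonisotropic_def by (intro CollectI exI[of _ "vec3 a 1 0"]) (simp add: hform_def)

lemma hform_affine: "hform (vec3 a b 1) (vec3 a b 1) = a + cj a + b * cj b"
  by (simp add: hform_def add_ac)

lemma nonisotropic_affine_iff: "point (vec3 a b 1) \<in> nonisotropic \<longleftrightarrow> a + cj a + b * cj b \<noteq> 0"
proof
  assume "point (vec3 a b 1) \<in> nonisotropic"
  then obtain x where x: "hform x x \<noteq> 0" "point (vec3 a b 1) = point x" unfolding nonisotropic_def by blast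
  then obtain c where "x = c *s vec3 a b 1" unfolding point_eq_iff by blast
  then show "a + cj a + b * cj b \<noteq> 0" using x(1) by (auto simp: hform_scale hform_affine)
next
  assume "a + cj a + b * cj b \<noteq> 0"
  then show "point (vec3 a b 1) \<in> nonisotropic"
    unfolding nonisotropic_def by (intro CollectI exI[of _ "vec3 a b 1"]) (simp add: hform_affine)
qed

lemma nonisotropic_cases:
  assumes "P \<in> nonisotropic"
  obtains a where "P = point (vec3 a 1 0)" | a b where "P = point (vec3 a b 1)"
proof -
  obtain x where x: "P = point x" "hform x x \<noteq> 0" using assms unfolding nonisotropic_def by blast
  then have "x $ 2 \<noteq> 0 \<or> x $ 3 \<noteq> 0" by (auto simp: hform_def)
  then show ?thesis using that x(1) point_eq_affine[of x] point_eq_at_infinity[of x] by metis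
qed

lemma nonisotropic_in_orbit_e2:
  assumes "x + cj x \<noteq> 0"
  shows "point (vec3 x 0 1) \<in> orbit SU matrix_image (point e2)"
proof -
  obtain m where m: "m * cj m = inverse (x + cj x)"
    using norm_surj[of "inverse (x + cj x)"] by (auto simp: add.commute)
  have m1: "m * cj m * x + m * cj m * cj x = 1" and m0: "cj m \<noteq> 0"
    using m assms by (auto simp flip: distrib_left)
  have "m * (x * (cj m * 4)) + m * (cj m * (cj x * 4)) = 4 * (m * cj m * x + m * cj m * cj x)"
    by (simp add: algebra_simps)
  then have m4: "m * (x * (cj m * 4)) + m * (cj m * (cj x * 4)) = 4" unfolding m1 by simp
  define A where "A = mat3 (- m * cj x) (cj m * x) (m * cj x / 2) 1 0 (1 / 2) m (cj m) (- m / 2)"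
  have "A \<in> carrier SU"
    by (rule SU_I) (use m1 m4 in \<open>simp_all add: A_def det_3 hform_def column_def field_simps\<close>)
  moreover have "A *v e2 = cj m *s vec3 x 0 1" by (simp add: A_def vec3_eq_iff matrix_vector_mult_3)
  then have "point (A *v e2) = point (vec3 x 0 1)" using m0 by (simp add: point_scale)
  ultimately show ?thesis unfolding orbit_def by (auto intro: exI[of _ A])
qed

context
  fixes U :: "('a^3^3) set"
  assumes U_unipotent: "U \<subseteq> {A\<in>borel. A $ 1 $ 1 = 1}" and U_transversal: "bij_betw (\<lambda>A. A $ 2 $ 3) U UNIV"
begin

lemma transversal_image:
  assumes "A \<in> U"
  shows "A *v e2 = vec3 (- cj (A $ 2 $ 3)) 1 0" "A *v vec3 x 0 1 = vec3 (x + A $ 1 $ 3) (A $ 2 $ 3) 1"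
  using assms U_unipotent unipotent_image[of A] by auto

lemma transversal_eqI: "A \<in> U \<Longrightarrow> B \<in> U \<Longrightarrow> A $ 2 $ 3 = B $ 2 $ 3 \<Longrightarrow> A = B"
  using inj_onD[OF bij_betw_imp_inj_on[OF U_transversal]] by blast

lemma transversal_exists: "\<exists>A\<in>U. A $ 2 $ 3 = b"
proof -
  have "b \<in> (\<lambda>A. A $ 2 $ 3) ` U" using bij_betw_imp_surj_on[OF U_transversal] by simp
  then show ?thesis by auto
qed

lemma transversal_shift:
  assumes "A \<in> U"
  shows "x + A $ 1 $ 3 + cj (x + A $ 1 $ 3) + A $ 2 $ 3 * cj (A $ 2 $ 3) = x + cj x"
proof -
  have "A \<in> carrier SU" using assms U_unipotent by (auto simp: mem_point_stabilizer_iff)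
  from hform_SU[OF this, of "vec3 x 0 1" "vec3 x 0 1"] show ?thesis
    unfolding transversal_image(2)[OF assms] hform_affine by simp
qed

lemma tiling_points_at_infinity: "tiling matrix_image U {point e2} (range (\<lambda>a. point (vec3 a 1 0)))"
proof (rule tilingI)
  fix Q :: "('a^3) set" assume "Q \<in> range (\<lambda>a. point (vec3 a 1 0))"
  then obtain a where Q: "Q = point (vec3 a 1 0)" by blast
  obtain A where "A \<in> U" "A $ 2 $ 3 = - cj a" using transversal_exists by blast
  then show "\<exists>A\<in>U. \<exists>P\<in>{point e2}. matrix_image A P = Q"
    using Q by (intro bexI[of _ A]) (simp_all add: transversal_image)
qed (auto simp: transversal_image point_vec3_eq_iff intro: transversal_eqI)

lemma tiling_nonisotropic_affine:
  "tiling matrix_image U ((\<lambda>x. point (vec3 x 0 1)) ` {x. x + cj x \<noteq> 0})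
    (nonisotropic \<inter> range (\<lambda>(a, b). point (vec3 a b 1)))"
  (is "tiling _ U (?p ` ?D) ?affine")
proof (rule tilingI)
  fix Q assume "Q \<in> ?affine"
  then obtain a b where Q: "Q = point (vec3 a b 1)" "a + cj a + b * cj b \<noteq> 0"
    using nonisotropic_affine_iff by auto
  obtain A where A: "A \<in> U" "A $ 2 $ 3 = b" using transversal_exists by blast
  define x where "x = a - A $ 1 $ 3"
  have a: "a = x + A $ 1 $ 3" by (simp add: x_def)
  have "x + cj x = a + cj a + b * cj b" using transversal_shift[OF A(1), of x] unfolding a A(2) by (rule sym)
  then have "x \<in> ?D" using Q(2) by (simp only: mem_Collect_eq not_False_eq_True)
  moreover have "matrix_image A (?p x) = Q" using A Q(1) by (simp add: transversal_image a)
  ultimately show "\<exists>A\<in>U. \<exists>P\<in>?p ` ?D. matrix_image A P = Q" using A(1) by blast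
next
  fix A P assume "A \<in> U" "P \<in> ?p ` ?D"
  then obtain x where x: "x + cj x \<noteq> 0" "matrix_image A P = point (vec3 (x + A $ 1 $ 3) (A $ 2 $ 3) 1)"
    by (auto simp: transversal_image)
  then have "point (vec3 (x + A $ 1 $ 3) (A $ 2 $ 3) 1) \<in> nonisotropic"
    unfolding nonisotropic_affine_iff transversal_shift[OF \<open>A \<in> U\<close>] by simp
  then show "matrix_image A P \<in> ?affine" using x(2) by auto
next
  fix A B P Q
  assume eq: "A \<in> U" "B \<in> U" "P \<in> ?p ` ?D" "Q \<in> ?p ` ?D" "matrix_image A P = matrix_image B Q"
  then obtain x y where xy: "P = ?p x" "Q = ?p y" by blast
  then have "x + A $ 1 $ 3 = y + B $ 1 $ 3" "A $ 2 $ 3 = B $ 2 $ 3"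
    using eq(1,2,5) by (simp_all add: transversal_image point_vec3_eq_iff)
  then show "A = B \<and> P = Q" using transversal_eqI[OF eq(1,2)] xy by simp
qed

lemma tiling_nonisotropic:
  "tiling matrix_image U (insert (point e2) ((\<lambda>x. point (vec3 x 0 1)) ` {x. x + cj x \<noteq> 0})) nonisotropic"
proof -
  let ?infinite = "range (\<lambda>a. point (vec3 a 1 0)) :: ('a^3) set set"
  let ?affine = "nonisotropic \<inter> range (\<lambda>(a, b). point (vec3 a b 1))"
  have "P \<in> ?infinite \<union> ?affine" if "P \<in> nonisotropic" for P
    using that by (cases rule: nonisotropic_cases) (use that in auto)
  then have "?infinite \<union> ?affine = nonisotropic" using nonisotropic_at_infinity by blast
  moreover have "?infinite \<inter> ?affine = {}" by (auto simp: point_vec3_eq_iff)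
  ultimately show ?thesis
    using tiling_Un[OF tiling_points_at_infinity tiling_nonisotropic_affine] by simp
qed

end

lemma orbit_e2_subset: "orbit SU matrix_image (point e2) \<subseteq> nonisotropic"
proof
  fix P assume "P \<in> orbit SU matrix_image (point e2)"
  then obtain A where A: "A \<in> carrier SU" "P = point (A *v e2)" by (auto simp: orbit_def)
  have "hform (A *v e2) (A *v e2) = 1" using hform_SU[OF A(1)] by (simp add: hform_def)
  then show "P \<in> nonisotropic" using A(2) unfolding nonisotropic_def by force
qed

theorem min_factorisable_SU_prime:
  assumes "prime (q ^ 2 - q + 1)"
  shows "min_factorisable SU (carrier SU)"
proof (rule points.min_factorisable_if_min_tiles_orbit)
  define D where "D = {x. x + cj x \<noteq> 0}"
  define P where "P = insert (point e2) ((\<lambda>x. point (vec3 x 0 1)) ` D)"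
  obtain U where U: "U \<subseteq> {A\<in>borel. A $ 1 $ 1 = 1}" "min_factorisable SU U" "bij_betw (\<lambda>A. A $ 2 $ 3) U UNIV"
    by (rule unipotent_transversal)
  have tiling: "tiling matrix_image U P nonisotropic"
    unfolding P_def D_def using U(1,3) by (rule tiling_nonisotropic)
  have "D = UNIV - {x. x + cj x = 0}" by (auto simp: D_def)
  then have "card D = q ^ 2 - q" using card_trace_fibre[of 0] by (simp add: card_Diff_subset card_field)
  moreover have "inj_on (\<lambda>x. point (vec3 x 0 1)) D" by (simp add: inj_on_def point_vec3_eq_iff)
  moreover have "point e2 \<notin> (\<lambda>x. point (vec3 x 0 1)) ` D" by (auto simp: point_vec3_eq_iff)
  ultimately have card_P: "card P = q ^ 2 - q + 1" by (simp add: P_def card_image)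
  have P: "P \<subseteq> orbit SU matrix_image (point e2)"
    using nonisotropic_in_orbit_e2 points.orbit_refl by (auto simp: P_def D_def)
  have "U \<subseteq> carrier SU" using U(1) by (auto simp: mem_point_stabilizer_iff)
  then have "orbit SU matrix_image (point e2) = nonisotropic"
    using orbit_e2_subset points.tiling_subset_orbit[OF tiling _ P] by auto
  moreover have "min_tiles SU matrix_image {point e2} P"
    using P assms by (intro points.min_tiles_prime_card) (simp_all add: card_P)
  moreover have "min_tiles SU matrix_image P nonisotropic"
    using U(2) tiling unfolding min_tiles_def by blast
  moreover have "nonisotropic \<noteq> {}" using nonisotropic_at_infinity by blast
  ultimately show "min_tiles SU matrix_image {point e2} (orbit SU matrix_image (point e2))"
    using points.min_tiles_trans[of "{point e2}" P nonisotropic] by simp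
qed (simp_all add: min_factorisable_stabilizer_e2)

section \<open>Isotropic points\<close>

definition isotropic :: "('a^3) set set" where
  "isotropic = {point x | x. x \<noteq> 0 \<and> hform x x = 0}"

lemma isotropic_invariant:
  assumes "A \<in> carrier SU" "P \<in> isotropic"
  shows "matrix_image A P \<in> isotropic"
proof -
  obtain x where "P = point x" "x \<noteq> 0" "hform x x = 0" using assms(2) unfolding isotropic_def by blast
  then show ?thesis unfolding isotropic_def using assms(1)
    by (intro CollectI exI[of _ "A *v x"]) (simp add: hform_SU)
qed

lemma isotropic_e1: "point e1 \<in> isotropic"
  unfolding isotropic_def by (intro CollectI exI[of _ e1]) (simp add: vec3_eq_iff hform_def)

lemma isotropic_affine: "a + cj a + b * cj b = 0 \<Longrightarrow> point (vec3 a b 1) \<in> isotropic"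
  unfolding isotropic_def by (intro CollectI exI[of _ "vec3 a b 1"]) (simp add: vec3_eq_iff hform_affine)

lemma isotropic_cases:
  assumes "P \<in> isotropic"
  obtains "P = point e1" | a b where "P = point (vec3 a b 1)" "a + cj a + b * cj b = 0"
proof -
  obtain x where x: "P = point x" "x \<noteq> 0" "hform x x = 0" using assms unfolding isotropic_def by blast
  show ?thesis
  proof (cases "x $ 3 = 0")
    case True
    then have "x $ 2 = 0" using x(3) by (simp add: hform_def)
    then have "x = x $ 1 *s e1" "x $ 1 \<noteq> 0" using True x(2) by (simp_all add: vec3_eq_iff)
    then show ?thesis using that(1) x(1) point_scale by metis
  next
    case False
    define y where "y = vec3 (x $ 1 / x $ 3) (x $ 2 / x $ 3) 1"
    have "y = inverse (x $ 3) *s x" using False by (simp add: y_def vec3_eq_iff field_simps)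
    then have "hform y y = 0" using x(3) by (simp add: hform_scale)
    then show ?thesis using that(2) point_eq_affine[OF False] x(1) by (simp add: y_def hform_affine)
  qed
qed

lemma card_isotropic: "card isotropic = q ^ 3 + 1"
proof -
  define D where "D = (SIGMA b:UNIV. {a. a + cj a = - (b * cj b)})"
  define f where "f = (\<lambda>(b, a). point (vec3 a b (1 :: 'a)))"
  have "isotropic = insert (point e1) (f ` D)"
  proof (intro equalityI subsetI)
    fix P assume "P \<in> isotropic"
    then show "P \<in> insert (point e1) (f ` D)"
    proof (cases rule: isotropic_cases)
      case (2 a b)
      then have "(b, a) \<in> D" by (simp add: D_def eq_neg_iff_add_eq_0)
      then show ?thesis using 2(1) unfolding f_def by force
    qed simp
  next
    fix P assume "P \<in> insert (point e1) (f ` D)"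
    then show "P \<in> isotropic"
      using isotropic_e1 isotropic_affine by (auto simp: D_def f_def eq_neg_iff_add_eq_0)
  qed
  moreover have "point e1 \<notin> f ` D" using point_vec3_eq_iff(4) by (auto simp: f_def)
  moreover have "inj_on f D" by (auto simp: inj_on_def f_def point_vec3_eq_iff)
  moreover have "card D = (\<Sum>b\<in>UNIV. card {a. a + cj a = - (b * cj b)})"
    unfolding D_def by (rule card_SigmaI) auto
  moreover have "card {a. a + cj a = - (b * cj b)} = q" for b
    by (rule card_trace_fibre) (simp add: mult.commute)
  ultimately show ?thesis
    by (simp add: card_image card_field power2_eq_square power3_eq_cube)
qed

lemma unip_image: "unip \<alpha> \<beta> *v e3 = vec3 \<beta> \<alpha> 1" "unip \<alpha> \<beta> *v e1 = e1"
  by (simp_all add: unip_def vec3_eq_iff matrix_vector_mult_3)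

lemma weyl_image: "weyl *v e1 = e3" "weyl *v e3 = e1"
  by (simp_all add: weyl_def vec3_eq_iff matrix_vector_mult_3)

lemma isotropic_transitive:
  assumes "P \<in> isotropic"
  shows "\<exists>A\<in>carrier SU. point (A *v e1) = P"
  using assms
proof (cases rule: isotropic_cases)
  case 1
  then show ?thesis using SU.one_closed by (intro bexI[of _ "mat 1"]) simp_all
next
  case (2 a b)
  then have "unip b a ** weyl \<in> carrier SU"
    using SU.m_closed[OF unip_in_SU weyl_in_SU] by simp
  moreover have "(unip b a ** weyl) *v e1 = vec3 a b 1"
    by (simp add: unip_image weyl_image flip: matrix_vector_mul_assoc)
  ultimately show ?thesis using 2(1) by (intro bexI[of _ "unip b a ** weyl"]) simp_all
qed

lemma isotropic_two_transitive_from_e1_e3: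
  assumes "P \<in> isotropic" "Q \<in> isotropic" "P \<noteq> Q"
  shows "\<exists>A\<in>carrier SU. point (A *v e1) = P \<and> point (A *v e3) = Q"
proof -
  obtain A where A: "A \<in> carrier SU" "point (A *v e1) = P" using isotropic_transitive[OF assms(1)] by blast
  define R where "R = matrix_image (inv\<^bsub>SU\<^esub> A) Q"
  have R: "R \<in> isotropic" "matrix_image A R = Q"
    using assms(2) A(1) isotropic_invariant SU.r_inv[OF A(1)]
    by (simp_all add: R_def flip: matrix_image_mult)
  then have "R \<noteq> point e1" using A(2) assms(3) by auto
  then obtain a b where R': "R = point (vec3 a b 1)" and ab: "a + cj a + b * cj b = 0"
    using isotropic_cases[OF R(1)] by metis
  have "A ** unip b a \<in> carrier SU" using SU.m_closed[OF A(1) unip_in_SU[OF ab]] by simp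
  moreover have "point ((A ** unip b a) *v e1) = P" "point ((A ** unip b a) *v e3) = Q"
    using A(2) R(2) R' by (simp_all add: unip_image flip: matrix_vector_mul_assoc)
  ultimately show ?thesis by blast
qed

sublocale isotropic: two_transitive_action SU UNIV matrix_image isotropic
proof
  show "\<exists>A\<in>carrier SU. matrix_image A P = P' \<and> matrix_image A Q = Q'"
    if PQ: "P \<in> isotropic" "Q \<in> isotropic" "P \<noteq> Q" "P' \<in> isotropic" "Q' \<in> isotropic" "P' \<noteq> Q'" for P Q P' Q'
  proof -
    obtain A B where A: "A \<in> carrier SU" "point (A *v e1) = P" "point (A *v e3) = Q"
      and B: "B \<in> carrier SU" "point (B *v e1) = P'" "point (B *v e3) = Q'"
      using isotropic_two_transitive_from_e1_e3 PQ by metis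
    have "inv\<^bsub>SU\<^esub> A *v (A *v x) = x" for x
      using SU.l_inv[OF A(1)] by (simp add: matrix_vector_mul_assoc)
    then have "matrix_image (B \<otimes>\<^bsub>SU\<^esub> inv\<^bsub>SU\<^esub> A) P = P'" "matrix_image (B \<otimes>\<^bsub>SU\<^esub> inv\<^bsub>SU\<^esub> A) Q = Q'"
      using A(2,3) B(2,3) by (auto simp flip: matrix_vector_mul_assoc)
    then show ?thesis using A(1) B(1) SU.m_closed SU.inv_closed by blast
  qed
  show "\<exists>A\<in>carrier SU. matrix_image A P = Q" if "P \<in> isotropic" "Q \<in> isotropic" for P Q
  proof -
    have "P \<in> orbit SU matrix_image (point e1)" "Q \<in> orbit SU matrix_image (point e1)"
      using isotropic_transitive that by (force simp: orbit_def)+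
    then have "Q \<in> orbit SU matrix_image P"
      using points.orbit_sym points.orbit_trans by blast
    then show ?thesis by (auto simp: orbit_def)
  qed
qed (simp_all add: isotropic_invariant)

lemma orbit_e1: "orbit SU matrix_image (point e1) = isotropic"
proof (intro equalityI subsetI)
  show "P \<in> isotropic" if "P \<in> orbit SU matrix_image (point e1)" for P
    using that isotropic_invariant[OF _ isotropic_e1] by (auto simp: orbit_def)
  show "P \<in> orbit SU matrix_image (point e1)" if "P \<in> isotropic" for P
    using isotropic_transitive[OF that] by (auto simp: orbit_def)
qed

section \<open>A cyclic subgroup of order q^2 - q + 1\<close>

definition singer_order :: nat where
  "singer_order = q ^ 2 - q + 1"

lemma singer_order_eq: "singer_order = q * (q - 1) + 1"
  by (simp add: singer_order_def power2_eq_square diff_mult_distrib2)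

lemma singer_order_add: "singer_order + q = q ^ 2 + 1"
proof -
  have "q \<le> q ^ 2" by (simp add: power2_eq_square)
  then show ?thesis by (simp add: singer_order_def)
qed

lemma singer_order_gt: "singer_order > q"
proof -
  have "q * 2 \<le> q ^ 2" using q_gt_2 by (simp add: power2_eq_square)
  then show ?thesis using singer_order_add by linarith
qed

lemma singer_order_add_3_mult: "singer_order + 3 * q = (q + 1) * (q + 1)"
  using singer_order_add by (simp add: power2_eq_square)

lemma singer_order_mult: "(q + 1) * singer_order = q ^ 3 + 1"
  and singer_order_dvd: "singer_order dvd q ^ 4 + q ^ 2 + 1"
proof -
  obtain m where m: "q = Suc m" using q_gt_2 by (cases q) auto
  then have "q - 1 = m" by simp
  then have r: "singer_order = q * m + 1" using singer_order_eq by metis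
  show "(q + 1) * singer_order = q ^ 3 + 1"
    unfolding r unfolding m by (simp add: power3_eq_cube algebra_simps)
  have "q ^ 4 + q ^ 2 + 1 = singer_order * (q ^ 2 + q + 1)"
    unfolding r unfolding m by (simp add: power2_eq_square power4_eq_xxxx algebra_simps)
  then show "singer_order dvd q ^ 4 + q ^ 2 + 1" by (rule dvdI)
qed

lemma coprime_singer_order:
  assumes "\<not> 3 dvd q + 1"
  shows "coprime singer_order (q ^ 2 - 1)"
proof -
  have "q ^ 2 - 1 = (q - 1) * (q + 1)" using q_gt_2 by (simp add: algebra_simps power2_eq_square)
  moreover have "coprime singer_order (q - 1)"
  proof (rule coprimeI)
    fix d assume d: "d dvd singer_order" "d dvd q - 1"
    then have "d dvd q * (q - 1)" by simp
    then show "is_unit d" using d(1) unfolding singer_order_eq by (simp only: dvd_add_right_iff)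
  qed
  moreover have "coprime singer_order (q + 1)"
  proof (rule coprimeI)
    fix d assume d: "d dvd singer_order" "d dvd q + 1"
    have "d dvd singer_order + 3 * q" using d(2) unfolding singer_order_add_3_mult by (rule dvd_mult2)
    then have "d dvd 3 * q" using d(1) by (simp only: dvd_add_right_iff)
    moreover have "coprime d q"
    proof (rule coprimeI)
      fix e assume "e dvd d" "e dvd q"
      then have "e dvd q + 1" using d(2) dvd_trans by blast
      then show "is_unit e" using \<open>e dvd q\<close> by (simp only: dvd_add_right_iff)
    qed
    ultimately have "d dvd 3" by (simp add: coprime_dvd_mult_left_iff)
    moreover have "coprime 3 (q + 1)" using assms prime_imp_coprime[of 3 "q + 1"] by simp
    ultimately show "is_unit d" using d(2) coprime_common_divisor by blast
  qed
  ultimately show ?thesis by (simp only: coprime_mult_right_iff)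
qed

lemma frobenius_add: "(x + y :: 'a alg_closure) ^ q = x ^ q + y ^ q"
  using q_eq_CHAR_power prime_CHAR freshmans_dream'[where ?'a = "'a alg_closure"] by auto

lemma frobenius_square_add: "(x + y :: 'a alg_closure) ^ (q ^ 2) = x ^ (q ^ 2) + y ^ (q ^ 2)"
  by (simp add: power2_eq_square power_mult frobenius_add)

lemma frobenius_eq_iff: "x ^ q = y ^ q \<longleftrightarrow> (x :: 'a alg_closure) = y"
proof
  assume eq: "x ^ q = y ^ q"
  have "x ^ q = (x - y) ^ q + y ^ q" using frobenius_add[of "x - y" y] by simp
  then show "x = y" using eq by simp
qed simp

lemma to_ac_cj: "to_ac (cj x) = to_ac x ^ q"
  by (simp add: cj_def)

lemma frobenius_square_to_ac: "to_ac (x :: 'a) ^ (q ^ 2) = to_ac x"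
  using finite_field_power_card(2)[of x] by (simp add: card_field flip: to_ac_power)

lemma in_range_to_ac:
  fixes x :: "'a alg_closure"
  assumes "x ^ (q ^ 2) = x"
  shows "x \<in> range to_ac"
proof -
  let ?S = "{x :: 'a alg_closure. x ^ (q ^ 2) = x}" and ?p = "monom 1 (q ^ 2) - monom 1 1 :: 'a alg_closure poly"
  have q2: "1 < q ^ 2" using q_gt_2 by (intro one_less_power) auto
  then have "coeff ?p (q ^ 2) = 1" by simp
  then have "?p \<noteq> 0" by (metis coeff_0 zero_neq_one)
  then have "finite {x. poly ?p x = 0}" by (rule poly_roots_finite)
  then have "finite ?S" by (simp add: poly_monom)
  moreover have "card ?S \<le> q ^ 2"
    by (rule card_le_if_roots[of ?p]) (use q2 in \<open>auto simp: poly_monom degree_monom_eq intro!: degree_diff_le\<close>)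
  moreover have "range to_ac \<subseteq> ?S"
    by (auto simp: frobenius_square_to_ac simp del: to_ac_power)
  moreover have "card (range (to_ac :: 'a \<Rightarrow> _)) = q ^ 2"
    by (simp add: card_image inj_to_ac card_field)
  ultimately have "range to_ac = ?S" by (intro card_seteq) auto
  then show ?thesis using assms by auto
qed

lemma singer_root_exists: "\<exists>c :: 'a alg_closure. primitive_root singer_order c"
proof (rule primitive_root_exists)
  show "of_nat singer_order \<noteq> (0 :: 'a alg_closure)"
  proof
    assume "of_nat singer_order = (0 :: 'a alg_closure)"
    then have char: "CHAR('a) dvd singer_order" by (simp add: of_nat_eq_0_iff_char_dvd)
    obtain k where k: "q = CHAR('a) ^ k" using q_eq_CHAR_power by blast
    then have "CHAR('a) dvd q" using q_gt_2 by (cases k) auto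
    then have "CHAR('a) dvd 1" using char singer_order_eq by (metis dvd_add_right_iff dvd_mult2)
    then show False using prime_CHAR by simp
  qed
qed

context
  fixes c :: "'a alg_closure"
  assumes not_3_dvd: "\<not> 3 dvd q + 1" and singer_root: "primitive_root singer_order c"
begin

lemma singer_root_power_eq_1_iff: "c ^ t = 1 \<longleftrightarrow> singer_order dvd t"
  using singer_root by (simp add: primitive_root_def)

lemma singer_root_neq_0: "c \<noteq> 0"
proof
  assume "c = 0"
  then have "c ^ singer_order = 0" by (simp add: singer_order_def)
  moreover have "c ^ singer_order = 1" using singer_root_power_eq_1_iff by simp
  ultimately show False by (metis zero_neq_one)
qed

lemma singer_root_power_eq_iff: "c ^ Suc t = c \<longleftrightarrow> singer_order dvd t"
  using singer_root_neq_0 singer_root_power_eq_1_iff by simp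

lemma singer_conjugates_distinct: "card {c, c ^ (q ^ 2), c ^ (q ^ 4)} = 3"
proof -
  have Suc: "q ^ n = Suc (q ^ n - 1)" for n using q_gt_2 by simp
  have cop: "coprime singer_order (q ^ 2 - 1)" using not_3_dvd by (rule coprime_singer_order)
  have "\<not> singer_order dvd q ^ 2 - 1"
    using cop singer_order_gt q_gt_2 by (metis coprime_absorb_left less_one nat_dvd_1_iff_1 not_less_iff_gr_or_eq less_trans)
  then have c_c2: "c \<noteq> c ^ (q ^ 2)" using singer_root_power_eq_iff[of "q ^ 2 - 1"] Suc[of 2] by metis
  have "\<not> singer_order dvd q ^ 4 - 1"
  proof
    assume "singer_order dvd q ^ 4 - 1"
    also have "q ^ 4 - 1 = (q ^ 2 - 1) * (q ^ 2 + 1)"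
      using q_gt_2 by (simp add: diff_mult_distrib algebra_simps power2_eq_square power4_eq_xxxx)
    finally have "singer_order dvd q"
      using cop singer_order_add by (metis coprime_dvd_mult_right_iff dvd_add_triv_left_iff)
    then show False using singer_order_gt q_gt_2 by (auto dest: dvd_imp_le)
  qed
  then have c_c4: "c \<noteq> c ^ (q ^ 4)" using singer_root_power_eq_iff[of "q ^ 4 - 1"] Suc[of 4] by metis
  have "q ^ 4 = q ^ 2 * q ^ 2" by (simp flip: power_add)
  then have "c ^ (q ^ 2) \<noteq> c ^ (q ^ 4)"
    using c_c2 by (simp add: power_mult power2_eq_square frobenius_eq_iff)
  then show ?thesis using c_c2 c_c4 by simp
qed

lemma singer_root_independent:
  fixes A B C :: 'a
  assumes "to_ac A + to_ac B * c + to_ac C * c ^ 2 = 0"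
  shows "A = 0" "B = 0" "C = 0"
proof -
  define p where "p = [:to_ac A, to_ac B, to_ac C:]"
  have p: "poly p x = to_ac A + to_ac B * x + to_ac C * x ^ 2" for x
    by (simp add: p_def algebra_simps power2_eq_square)
  have root: "poly p (x ^ (q ^ 2)) = 0" if "poly p x = 0" for x
  proof -
    have "(x ^ (q ^ 2))\<^sup>2 = (x\<^sup>2) ^ (q ^ 2)" by (simp add: mult.commute flip: power_mult)
    then have "poly p (x ^ (q ^ 2)) = (poly p x) ^ (q ^ 2)"
      by (simp add: p frobenius_square_add power_mult_distrib frobenius_square_to_ac)
    then show ?thesis using that q_gt_2 by simp
  qed
  have "q ^ 4 = q ^ 2 * q ^ 2" by (simp flip: power_add)
  then have "poly p x = 0" if "x \<in> {c, c ^ (q ^ 2), c ^ (q ^ 4)}" for x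
    using that assms root[of c] root[of "c ^ (q ^ 2)"] by (auto simp: p simp flip: power_mult)
  then have "card {c, c ^ (q ^ 2), c ^ (q ^ 4)} \<le> degree p" if "p \<noteq> 0"
    using card_mono[OF poly_roots_finite[OF that], of "{c, c ^ (q ^ 2), c ^ (q ^ 4)}"]
      card_poly_roots_bound[OF that] by fastforce
  moreover have "degree p \<le> 2" by (simp add: p_def)
  ultimately have "p = 0" using singer_conjugates_distinct by fastforce
  then show "A = 0" "B = 0" "C = 0" by (simp_all add: p_def)
qed

lemma singer_cubic: "\<exists>\<tau> :: 'a. c ^ 3 - to_ac \<tau> * c ^ 2 + to_ac (cj \<tau>) * c - 1 = 0"
proof -
  define c2 c4 where "c2 = c ^ (q ^ 2)" and "c4 = c ^ (q ^ 4)"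
  have "c ^ (q ^ 4 + q ^ 2 + 1) = 1" using singer_root_power_eq_1_iff singer_order_dvd by blast
  then have prod: "c * c2 * c4 = 1" by (simp add: c2_def c4_def power_add mult_ac)
  have "c ^ (q ^ 3 + 1) = 1" using singer_root_power_eq_1_iff singer_order_mult by (metis dvd_triv_right)
  then have "c ^ (q ^ 3) = inverse c" by (simp add: inverse_unique mult.commute)
  then have q3: "((c ^ q) ^ q) ^ q = inverse c" by (simp add: power3_eq_cube power_mult)
  have c2: "c2 = (c ^ q) ^ q" and c4: "c4 = inverse (c ^ q)"
    using q3 by (simp_all add: c2_def c4_def power2_eq_square power4_eq_xxxx power_mult power_inverse)
  have conj: "c2 ^ q = inverse c" "c4 ^ q = inverse c2" "c ^ q = inverse c4"
    using q3 by (simp_all add: c2 c4 power_inverse)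
  define t where "t = c + c2 + c4"
  have t_q: "t ^ q = inverse c + inverse c2 + inverse c4"
    by (simp add: t_def frobenius_add conj add_ac)
  have "t ^ (q ^ 2) = (t ^ q) ^ q" by (simp add: power2_eq_square power_mult)
  also have "\<dots> = t" unfolding t_q by (simp add: t_def frobenius_add power_inverse conj add_ac)
  finally obtain \<tau> where \<tau>: "t = to_ac \<tau>" using in_range_to_ac by blast
  have "inverse c = c2 * c4" "inverse c2 = c * c4" "inverse c4 = c * c2"
    using prod by (auto intro!: inverse_unique simp: mult_ac)
  then have "t ^ q = c * c2 + c2 * c4 + c * c4" unfolding t_q by (simp add: add_ac)
  then have "c ^ 3 - t * c ^ 2 + t ^ q * c - 1 = 0"
    using prod by (simp add: t_def power2_eq_square power3_eq_cube algebra_simps)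
  then show ?thesis by (auto simp: \<tau> to_ac_cj)
qed

lemma singer_trace_neq:
  assumes cubic: "c ^ 3 - to_ac \<tau> * c ^ 2 + to_ac (cj \<tau>) * c - 1 = 0"
  shows "\<tau> + cj \<tau> + 2 \<noteq> 0"
proof
  assume "\<tau> + cj \<tau> + 2 = 0"
  then have "cj \<tau> + (\<tau> + 2) = 0" by (simp add: algebra_simps)
  then have cj_\<tau>: "cj \<tau> = - (\<tau> + 2)" by (simp only: eq_neg_iff_add_eq_0)
  have "(c + 1) * (to_ac (- 1) + to_ac (- (\<tau> + 1)) * c + to_ac 1 * c ^ 2)
      = c ^ 3 - to_ac \<tau> * c ^ 2 + to_ac (cj \<tau>) * c - 1"
    unfolding cj_\<tau> by (simp add: algebra_simps power2_eq_square power3_eq_cube)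
  also have "\<dots> = 0" by (rule cubic)
  finally have "(c + 1) * (to_ac (- 1) + to_ac (- (\<tau> + 1)) * c + to_ac 1 * c ^ 2) = 0" .
  moreover have "c + 1 \<noteq> 0" using singer_root_independent(2)[of 1 1 0] by (auto simp: add.commute)
  ultimately have "to_ac (- 1) + to_ac (- (\<tau> + 1)) * c + to_ac 1 * c ^ 2 = 0" by simp
  then show False using singer_root_independent(3) by fastforce
qed

text \<open>The matrix is the product of the Weyl element and a unipotent one whose parameters are chosen so that
  it has the eigenvalue \<open>c\<close>. Since \<open>1, c, c\<^sup>2\<close> are linearly independent, a left eigenvector identifies
  the action of the matrix with multiplication by \<open>c\<close> on the cubic extension generated by \<open>c\<close>.\<close>

lemma singer_eigenvector:
  obtains M :: "'a^3^3" and l :: "'a^3 \<Rightarrow> 'a alg_closure" where "M \<in> carrier SU"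
    "\<And>x. l (M *v x) = c * l x" "\<And>k x. l (k *s x) = to_ac k * l x" "\<And>x y. l (x - y) = l x - l y"
    "\<And>x. l x = 0 \<Longrightarrow> x = 0"
proof -
  obtain \<tau> where cubic: "c ^ 3 - to_ac \<tau> * c ^ 2 + to_ac (cj \<tau>) * c - 1 = 0" using singer_cubic by blast
  have "cj (- (\<tau> + cj \<tau> + 2)) = - (\<tau> + cj \<tau> + 2)" by simp
  then obtain \<alpha> where \<alpha>: "\<alpha> * cj \<alpha> = - (\<tau> + cj \<tau> + 2)" using norm_surj by blast
  then have "\<alpha> \<noteq> 0" using singer_trace_neq[OF cubic] by (metis mult_zero_left neg_equal_0_iff_equal)
  define M where "M = weyl ** unip \<alpha> (\<tau> + 1)"
  define l where "l = (\<lambda>x :: 'a^3. to_ac (x $ 1) + to_ac (x $ 1 - cj \<alpha> * x $ 2 + x $ 3) * c + to_ac (x $ 3) * c ^ 2)"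
  show ?thesis
  proof (rule that[of M l])
    have "unip \<alpha> (\<tau> + 1) \<in> carrier SU" using \<alpha> by (intro unip_in_SU) simp
    then show "M \<in> carrier SU" using SU.m_closed[OF weyl_in_SU] by (simp add: M_def)
    show "l (M *v x) = c * l x" for x
    proof -
      have "M *v x = vec3 (x $ 3) (- x $ 2 - \<alpha> * x $ 3) (x $ 1 - cj \<alpha> * x $ 2 + (\<tau> + 1) * x $ 3)"
        by (simp add: M_def weyl_def unip_def matrix_vector_mult_3 matrix_matrix_mult_3 vec3_eq_iff)
      then have "l (M *v x) - c * l x = - to_ac (x $ 3) * (c ^ 3 - to_ac \<tau> * c ^ 2 + to_ac (cj \<tau>) * c - 1)
          + to_ac (\<alpha> * cj \<alpha> + \<tau> + cj \<tau> + 2) * to_ac (x $ 3) * c"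
        by (simp add: l_def algebra_simps power2_eq_square power3_eq_cube)
      also have "\<dots> = 0" unfolding cubic \<alpha> by simp
      finally show ?thesis by simp
    qed
    show "x = 0" if "l x = 0" for x
      using singer_root_independent[of "x $ 1" "x $ 1 - cj \<alpha> * x $ 2 + x $ 3" "x $ 3"] that \<open>\<alpha> \<noteq> 0\<close>
      by (auto simp: l_def vec3_eq_iff)
  qed (simp_all add: l_def algebra_simps)
qed

lemma singer_matrix:
  obtains M where "M \<in> carrier SU" "SU.ord M = singer_order"
    "\<And>(i :: nat) x. x \<noteq> 0 \<Longrightarrow> point ((M [^]\<^bsub>SU\<^esub> i) *v x) = point x \<Longrightarrow> M [^]\<^bsub>SU\<^esub> i = mat 1"
proof -
  obtain M :: "'a^3^3" and l :: "'a^3 \<Rightarrow> 'a alg_closure" where M: "M \<in> carrier SU"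
    and l: "\<And>x. l (M *v x) = c * l x" "\<And>k x. l (k *s x) = to_ac k * l x" "\<And>x y. l (x - y) = l x - l y"
      "\<And>x. l x = 0 \<Longrightarrow> x = 0"
    by (rule singer_eigenvector) blast
  have l_pow: "l ((M [^]\<^bsub>SU\<^esub> i) *v x) = c ^ i * l x" for i :: nat and x
    by (induction i arbitrary: x) (simp_all add: l(1) mult_ac flip: matrix_vector_mul_assoc)
  have period: "M [^]\<^bsub>SU\<^esub> i = mat 1" if "singer_order dvd i" for i :: nat
  proof -
    have "c ^ i = 1" using that singer_root_power_eq_1_iff by simp
    then have "l ((M [^]\<^bsub>SU\<^esub> i) *v x - x) = 0" for x by (simp add: l(3) l_pow)
    then have "(M [^]\<^bsub>SU\<^esub> i) *v x = mat 1 *v x" for x using l(4) by fastforce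
    then show ?thesis unfolding matrix_eq by blast
  qed
  have free: "singer_order dvd i" if x: "x \<noteq> 0" "point ((M [^]\<^bsub>SU\<^esub> i) *v x) = point x" for i :: nat and x
  proof -
    obtain k where k: "k \<noteq> 0" "(M [^]\<^bsub>SU\<^esub> i) *v x = k *s x" using x(2)[symmetric] unfolding point_eq_iff by blast
    then have "c ^ i * l x = to_ac k * l x" using l_pow[of i x] by (simp only: l(2))
    then have "c ^ i = to_ac k" using l(4) x(1) by auto
    then have "c ^ (i * (q ^ 2 - 1)) = to_ac (k ^ (q ^ 2 - 1))" by (simp add: power_mult)
    also have "\<dots> = 1" using finite_field_power_card(1)[OF k(1)] by (simp add: card_field)
    finally have "singer_order dvd i * (q ^ 2 - 1)" using singer_root_power_eq_1_iff by simp
    then show ?thesis using coprime_singer_order[OF not_3_dvd] by (simp add: coprime_dvd_mult_left_iff)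
  qed
  have "e1 \<noteq> 0" by (simp add: vec3_eq_iff)
  then have "M [^]\<^bsub>SU\<^esub> i = mat 1 \<longleftrightarrow> singer_order dvd i" for i :: nat
    using period[of i] free[of e1 i] by (metis matrix_vector_mul_lid)
  then have "SU.ord M = singer_order" using SU.ord_unique[OF M] by simp
  then show ?thesis using that M free period by blast
qed

end

lemma singer_subgroup:
  assumes "\<not> 3 dvd q + 1"
  obtains C where "min_factorisable SU C" "card C = singer_order"
    "semiregular_subgroup SU UNIV matrix_image C isotropic"
proof -
  obtain M where M: "M \<in> carrier SU" "SU.ord M = singer_order"
    and free: "\<And>(i :: nat) x. x \<noteq> 0 \<Longrightarrow> point ((M [^]\<^bsub>SU\<^esub> i) *v x) = point x \<Longrightarrow> M [^]\<^bsub>SU\<^esub> i = mat 1"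
    using singer_root_exists singer_matrix[OF assms] by metis
  show ?thesis
  proof (rule that[of "generate SU {M}"])
    show "min_factorisable SU (generate SU {M})" using M(1) by (intro SU.min_factorisable_cyclic) simp_all
    show "card (generate SU {M}) = singer_order" using SU.generate_pow_card[OF M(1)] M(2) by simp
    show "semiregular_subgroup SU UNIV matrix_image (generate SU {M}) isotropic"
    proof (intro semiregular_subgroup.intro semiregular_subgroup_axioms.intro)
      show C: "subgroup (generate SU {M}) SU" using M(1) by (intro SU.generate_is_subgroup) simp
      show "matrix_image A P \<in> isotropic" if "A \<in> generate SU {M}" "P \<in> isotropic" for A P
        using isotropic_invariant subgroup.mem_carrier[OF C] that by blast
      show "A = \<one>\<^bsub>SU\<^esub>" if "A \<in> generate SU {M}" "P \<in> isotropic" "matrix_image A P = P" for A P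
        using that free SU.generate_pow_on_finite_carrier[OF _ M(1)] by (auto simp: isotropic_def)
    qed (simp_all add: points.group_action_axioms)
  qed
qed

lemma card_isotropic_deviation:
  assumes "p < q"
  shows "p * (card isotropic - singer_order)\<^sup>2 < singer_order\<^sup>2 * (card isotropic - 1)"
proof -
  have "card isotropic - singer_order = q * singer_order"
    using card_isotropic singer_order_mult by simp
  then have "p * (card isotropic - singer_order)\<^sup>2 = (q\<^sup>2 * singer_order\<^sup>2) * p" by (simp add: power_mult_distrib)
  also have "\<dots> < (q\<^sup>2 * singer_order\<^sup>2) * q" using assms singer_order_gt by simp
  also have "\<dots> = singer_order\<^sup>2 * (card isotropic - 1)"
    by (simp add: card_isotropic power2_eq_square power3_eq_cube)
  finally show ?thesis .
qed

theorem min_factorisable_SU_twice_prime: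
  assumes "\<not> 3 dvd q + 1" "prime p" "q + 1 = 2 * p"
  shows "min_factorisable SU (carrier SU)"
proof (rule points.min_factorisable_if_min_tiles_orbit)
  obtain C where C: "min_factorisable SU C" "card C = singer_order"
    and "semiregular_subgroup SU UNIV matrix_image C isotropic"
    using singer_subgroup[OF assms(1)] by metis
  then interpret C: semiregular_subgroup SU UNIV matrix_image C isotropic by simp
  let ?orbits = "orbit (SU\<lparr>carrier := C\<rparr>) matrix_image ` isotropic"
  have "singer_order * card ?orbits = singer_order * (2 * p)"
    using C.semiregular_orbits(3) C(2) card_isotropic singer_order_mult unfolding assms(3) by (simp only: mult_ac)
  then have card_orbits: "card ?orbits = 2 * p" using singer_order_gt by (simp only: mult_cancel1) simp
  have block: "W \<subseteq> isotropic \<and> card W = singer_order" if "W \<in> ?orbits" for W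
    using C.semiregular_orbits(2)[OF that] C(2) by simp
  have less: "p * (card isotropic - singer_order)\<^sup>2 < singer_order\<^sup>2 * (card isotropic - 1)"
    using assms(3) q_gt_2 by (intro card_isotropic_deviation) simp
  obtain a Y R where a: "a \<in> carrier SU" "a \<noteq> \<one>\<^bsub>SU\<^esub>" and Y: "Y \<subseteq> isotropic" "card Y = p"
    and R: "R \<subseteq> isotropic" "tiling matrix_image {\<one>\<^bsub>SU\<^esub>, a} Y R" "\<And>W. W \<in> ?orbits \<Longrightarrow> \<exists>!P. P \<in> R \<inter> W"
    by (rule isotropic.paired_blocks_transversal[OF block C.semiregular_orbits(1) card_orbits _ less])
       (use assms(2) prime_gt_0_nat in auto)
  have "card {\<one>\<^bsub>SU\<^esub>, a} = 2" using a(2) by simp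
  then have "min_factorisable SU {\<one>\<^bsub>SU\<^esub>, a}"
    using a(1) SU.one_closed by (intro SU.min_factorisable_prime_card) simp_all
  then have "min_tiles SU matrix_image Y R" using R(2) unfolding min_tiles_def by blast
  moreover have "tiling matrix_image C R isotropic" using R(1,3) by (intro C.tiling_semiregular) auto
  then have "min_tiles SU matrix_image R isotropic" using C(1) unfolding min_tiles_def by blast
  moreover have nonempty: "Y \<noteq> {}" "isotropic \<noteq> {}" using Y(2) assms(2) isotropic_e1 by auto
  ultimately have "min_tiles SU matrix_image Y isotropic"
    by (intro points.min_tiles_trans[of Y R isotropic]) simp_all
  moreover have "min_tiles SU matrix_image {point e1} Y"
    using Y assms(2) by (intro points.min_tiles_prime_card) (simp_all add: orbit_e1)
  ultimately show "min_tiles SU matrix_image {point e1} (orbit SU matrix_image (point e1))"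
    unfolding orbit_e1 using nonempty(2)
    by (intro points.min_tiles_trans[of "{point e1}" Y isotropic]) simp_all
  show "min_factorisable SU borel"
    by (rule min_factorisable_borel_subgroup[OF points.stabilizer_subgroup]) simp_all
qed simp_all

section \<open>Transfer to the projective special unitary group\<close>

definition std_form :: "'a^3 \<Rightarrow> 'a^3 \<Rightarrow> 'a" where
  "std_form x y = x $ 1 * cj (y $ 1) + x $ 2 * cj (y $ 2) + x $ 3 * cj (y $ 3)"

lemma std_form_adjoint: "std_form (A *v x) y = std_form x (conjT q A *v y)"
  by (simp add: std_form_def conjT_def matrix_vector_mult_3 algebra_simps flip: cj_def)

lemma std_form_nondegenerate:
  assumes "\<And>x. std_form x y = std_form x z"
  shows "y = z"
  using assms[of "vec3 1 0 0"] assms[of "vec3 0 1 0"] assms[of "vec3 0 0 1"]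
  by (simp add: std_form_def vec3_eq_iff)

lemma SU3_eq_special_isometry_group: "SU3 q = special_isometry_group std_form"
proof -
  have "A ** conjT q A = mat 1 \<longleftrightarrow> (\<forall>x y. std_form (A *v x) (A *v y) = std_form x y)" for A :: "'a^3^3"
  proof -
    have "A ** conjT q A = mat 1 \<longleftrightarrow> conjT q A ** A = mat 1" by (rule matrix_left_right_inverse)
    also have "\<dots> \<longleftrightarrow> (\<forall>y. (conjT q A ** A) *v y = y)" by (simp add: matrix_eq)
    also have "\<dots> \<longleftrightarrow> (\<forall>x y. std_form x ((conjT q A ** A) *v y) = std_form x y)"
      using std_form_nondegenerate by metis
    finally show ?thesis by (simp add: std_form_adjoint matrix_vector_mul_assoc)
  qed
  then show ?thesis by (auto simp: SU3_def SU3_set_def special_isometry_group_def)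
qed

lemma std_form_iso_hform: "\<exists>\<phi>. \<phi> \<in> iso (special_isometry_group std_form) SU"
proof -
  obtain s where s: "s * cj s = - 1" using norm_surj[of "- 1"] by auto
  define P where "P = mat3 1 0 (1 / 2) s 0 (- s / 2) 0 1 0"
  have "det P = s" by (simp add: P_def det_3)
  then have "invertible P" using s by (auto simp: invertible_det_nz)
  then obtain P' where P': "P ** P' = mat 1" "P' ** P = mat 1" unfolding invertible_def by blast
  have "std_form (P *v x) (P *v y) = hform x y" for x y
  proof -
    have "std_form (P *v x) (P *v y) = (x $ 1 + x $ 3 / 2) * (cj (y $ 1) + cj (y $ 3) / 2)
        + (s * cj s) * ((x $ 1 - x $ 3 / 2) * (cj (y $ 1) - cj (y $ 3) / 2)) + x $ 2 * cj (y $ 2)"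
      by (simp add: std_form_def P_def matrix_vector_mult_3 algebra_simps)
    also have "\<dots> = hform x y" unfolding s by (simp add: hform_def field_simps)
    finally show ?thesis .
  qed
  then show ?thesis using special_isometry_group_iso[OF P'] by blast
qed

lemma scalar_if_commutes:
  fixes Z :: "'a^3^3"
  assumes "\<And>A. A \<in> carrier (special_isometry_group std_form) \<Longrightarrow> Z ** A = A ** Z"
  shows "Z = mat (Z $ 1 $ 1)"
proof -
  define D where "D = mat3 1 0 0 0 (- 1) 0 0 0 (- 1 :: 'a)"
  define E where "E = mat3 (- 1) 0 0 0 1 0 0 0 (- 1 :: 'a)"
  define P where "P = mat3 0 1 0 0 0 1 1 0 (0 :: 'a)"
  have "D \<in> carrier (special_isometry_group std_form)" "E \<in> carrier (special_isometry_group std_form)"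
    "P \<in> carrier (special_isometry_group std_form)"
    by (simp_all add: mem_special_isometry_group_iff D_def E_def P_def det_3 std_form_def matrix_vector_mult_3)
  note commutes = this[THEN assms]
  have D: "(Z ** D) $ i $ j = (D ** Z) $ i $ j" and E: "(Z ** E) $ i $ j = (E ** Z) $ i $ j"
    and P: "(Z ** P) $ i $ j = (P ** Z) $ i $ j" for i j
    using commutes by simp_all
  have "Z $ 1 $ 2 = 0" "Z $ 1 $ 3 = 0" "Z $ 2 $ 1 = 0" "Z $ 3 $ 1 = 0"
    using D[of 1 2] D[of 1 3] D[of 2 1] D[of 3 1] by (simp_all add: D_def matrix_matrix_mult_3 neg_eq_self_iff)
  moreover have "Z $ 2 $ 3 = 0" "Z $ 3 $ 2 = 0"
    using E[of 2 3] E[of 3 2] by (simp_all add: E_def matrix_matrix_mult_3 neg_eq_self_iff)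
  moreover have "Z $ 2 $ 2 = Z $ 1 $ 1" "Z $ 3 $ 3 = Z $ 1 $ 1"
    using P[of 1 2] P[of 2 3] by (simp_all add: P_def matrix_matrix_mult_3)
  ultimately show ?thesis by (simp add: vec_eq_iff forall_3 mat_def)
qed

lemma center_SU3:
  assumes "\<not> 3 dvd q + 1"
  shows "group_center (SU3 q) = {mat 1 :: 'a^3^3}"
proof
  show "{mat 1} \<subseteq> group_center (SU3 q :: ('a^3^3) monoid)"
    unfolding SU3_eq_special_isometry_group
    by (simp add: group_center_def mem_special_isometry_group_iff)
  show "group_center (SU3 q) \<subseteq> {mat 1 :: 'a^3^3}"
  proof
    fix Z :: "'a^3^3" assume Z: "Z \<in> group_center (SU3 q)"
    then have "Z ** A = A ** Z" if "A \<in> carrier (special_isometry_group std_form)" for A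
      using that unfolding SU3_eq_special_isometry_group by (simp add: group_center_def)
    then obtain z where z: "Z = mat z" using scalar_if_commutes by blast
    have "Z \<in> carrier (special_isometry_group std_form)"
      using Z unfolding SU3_eq_special_isometry_group by (simp add: group_center_def)
    then have "det Z = 1" "std_form (Z *v e1) (Z *v e1) = std_form e1 e1"
      by (simp_all add: mem_special_isometry_group_iff)
    then have "z ^ 3 = 1" "z ^ (q + 1) = 1"
      by (simp_all add: z mat_def det_3 std_form_def matrix_vector_mult_3 cj_def power3_eq_cube)
    then have "z ^ gcd 3 (q + 1) = 1" by (intro power_gcd_eq_1) auto
    moreover have "gcd 3 (q + 1) = 1" using assms prime_imp_coprime[of 3 "q + 1"] by simp
    ultimately show "Z \<in> {mat 1}" by (simp add: z)
  qed
qed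

theorem has_MLS_PSU3:
  assumes "\<not> 3 dvd q + 1" "min_factorisable SU (carrier SU)"
  shows "has_MLS (PSU3 q :: ('a^3^3) set monoid)"
proof -
  let ?SU3 = "special_isometry_group std_form"
  interpret SU3: group ?SU3 by (rule group_special_isometry_group)
  have PSU3: "PSU3 q = ?SU3 Mod {\<one>\<^bsub>?SU3\<^esub>}"
    using center_SU3[OF assms(1)] by (simp add: PSU3_def SU3_eq_special_isometry_group)
  interpret PSU3: group "PSU3 q :: ('a^3^3) set monoid"
    unfolding PSU3 by (rule normal.factorgroup_is_group[OF SU3.one_is_normal])
  obtain \<phi> where "\<phi> \<in> iso ?SU3 SU" using std_form_iso_hform by blast
  then have "min_factorisable ?SU3 (carrier ?SU3)"
    using assms(2) by (rule SU3.min_factorisable_iso[OF SU.is_group])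
  moreover have "the_elem \<in> iso (PSU3 q) ?SU3" unfolding PSU3 by (rule SU3.trivial_factor_iso)
  ultimately show ?thesis
    by (intro has_MLS_if_min_factorisable PSU3.min_factorisable_iso[OF SU3.is_group])
qed

lemma not_3_dvd_if_prime_singer_order:
  assumes "prime (q ^ 2 - q + 1)"
  shows "\<not> 3 dvd q + 1"
proof
  assume "3 dvd q + 1"
  then have "3 dvd singer_order + 3 * q" unfolding singer_order_add_3_mult by (rule dvd_mult2)
  then have "3 dvd singer_order" by (simp only: dvd_add_left_iff dvd_triv_left)
  then have "singer_order = 3" using assms primes_dvd_imp_eq[of 3 singer_order] by (simp add: singer_order_def)
  then show False using singer_order_gt q_gt_2 by simp
qed

lemma not_3_dvd_if_twice_prime:
  assumes "q > 5" "prime p" "q + 1 = 2 * p"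
  shows "\<not> 3 dvd q + 1"
proof
  assume "3 dvd q + 1"
  then have "3 dvd p" using prime_dvd_mult_iff[of 3 2 p] assms(3) by simp
  then have "p = 3" using primes_dvd_imp_eq[of 3 p] assms(2) by simp
  then show False using assms(1,3) by simp
qed

end

theorem theorem4p4:
  fixes q :: nat
  assumes "CARD('a::{field,finite}) = q ^ 2"
    and "\<exists>p k. prime p \<and> k \<ge> 1 \<and> q = p ^ k"
    and "odd q"
  shows "(prime (q ^ 2 - q + 1) \<longrightarrow> has_MLS (PSU3 q :: ('a ^3^3) set monoid))
       \<and> ((q > 5 \<and> (\<exists>p::nat. prime p \<and> q + 1 = 2 * p)) \<longrightarrow> has_MLS (PSU3 q :: ('a ^3^3) set monoid))"
proof (intro conjI impI)
  interpret unitary_field q "TYPE('a)" by unfold_locales (use assms in auto)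
  show "has_MLS (PSU3 q :: ('a^3^3) set monoid)" if "prime (q ^ 2 - q + 1)"
    using not_3_dvd_if_prime_singer_order[OF that] min_factorisable_SU_prime[OF that] by (rule has_MLS_PSU3)
  show "has_MLS (PSU3 q :: ('a^3^3) set monoid)" if twice_prime: "q > 5 \<and> (\<exists>p. prime p \<and> q + 1 = 2 * p)"
  proof -
    obtain p where p: "q > 5" "prime p" "q + 1 = 2 * p" using twice_prime by blast
    have "\<not> 3 dvd q + 1" using p by (rule not_3_dvd_if_twice_prime)
    then show ?thesis by (intro has_MLS_PSU3 min_factorisable_SU_twice_prime[OF _ p(2,3)])
  qed
qed

end
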